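(* Let $D$ be a finite set, $M=\mathrm{QoI}(D)$. For every command $C$, every $W\subseteq\mathit{Var}$ and every $\sigma:\mathit{Var}\to M_1$, $$\alpha_\sigma(\mathbb J_W)\sqsubseteq\alpha^{\mathbb N}_\sigma(\mathbb J^{\mathbb N}_W),$$ where $\mathbb J_W=\bigotimes_{w\in W}\Delta_C(w)$ and $\mathbb J^{\mathbb N}_W=\bigotimes_{w\in W}\Delta^{\mathbb N}_C(w)$, the left side being the floor of sound join-preserving read-outs and the right side the ceiling of the renaming paradigm, with equality if and only if the labels are idempotent, i.e. $\sigma(v)\otimes\sigma(v)=\sigma(v)$ for every $v\in\mathit{Var}$. Here "floor" means: $\alpha_\sigma$ is itself a sound join-preserving read-out for $\sigma$, and $\beta(\mathbb J_W)\sqsupseteq\alpha_\sigma(\mathbb J_W)$ for every sound join-preserving read-out $\beta:\mathcal U\to M$ for $\sigma$. "Ceiling" means: for every type object $(\mathcal V,\iota,\{h_{\sigma'}\})$ and every $\Delta:\mathit{Var}\to\mathcal V_1$ with $1\vdash_{\mathcal V}\iota\{C\}\Delta$ derivable, $h_\sigma(\bigotimes_{w\in W}\Delta(w))\sqsupseteq\alpha^{\mathbb N}_\sigma(\mathbb J^{\mathbb N}_W)$.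
   Context: Quantale of information. $D$ is finite. $\mathrm{LoI}(D)$ is the set of equivalence relations on $D$ ordered by $P\sqsubseteq Q$ iff $Q\subseteq P$, so $P\sqcup Q=P\cap Q$, the least element $\mathrm{All}$ is the total relation and the greatest, $\mathrm{Id}$, is equality. For $\mathbb P\subseteq\mathrm{LoI}(D)$, $\mathrm{mix}(\mathbb P)$ is the set of equivalence relations each of whose cells is a cell of some member of $\mathbb P$, and $\mathrm{tc}(\mathbb P)={\downarrow}\mathrm{mix}(\mathbb P)$. $\mathrm{QoI}(D)$ is the set of $\mathbb P$ with $\mathrm{tc}(\mathbb P)=\mathbb P$, ordered by inclusion (written $\sqsubseteq$), with $\bigvee_i\mathbb P_i=\mathrm{tc}(\bigcup_i\mathbb P_i)$, $\mathbb P\otimes\mathbb Q=\mathrm{tc}\{P\sqcup Q\mid P\in\mathbb P,Q\in\mathbb Q\}$, unit $1=\{\mathrm{All}\}$; it is a commutative complete quantale (complete lattice with commutative monoid $(\otimes,1)$, $\otimes$ distributing over arbitrary joins). For a quantale $M$, $M_1=\{m\mid 1\sqsubseteq m\}$, $m^0=1$, $m^n$ is the $n$-fold tensor power, $m^*=\bigvee_{n\ge0}m^n$; empty tensors are $1$. Language. $\mathit{Var}$ is finite; stores are maps $\mathit{Var}\to\mathit{Val}$. $\mathit{Val}$ contains an encoding (injective image) of every quotient $D/P$, $P\in\mathrm{LoI}(D)$, and supports injective pairing; expressions include variables and tuples $\langle v_1,\dots,v_k\rangle$ of variables, interpreted injectively. Commands: $\mathsf{skip}$, $x:=E$, $C_1;C_2$,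 $\mathsf{if}\;E\;C_1\;C_2$, $\mathsf{while}\;E\;C$, with the standard semantics $\llbracket C\rrbracket$, a partial function on stores (undefined on nontermination). Expressions evaluate totally, their value depends only on the variables in $\mathit{fv}(E)$, and guards are decided by a fixed two-valued test on the value of $E$. $\mathit{asgn}(C)$ is the set of variables assigned in $C$. $\pi_W$ restricts a store to $W$. Mediators. For a partial function $h$ on $D$ and $\mathbb P\in\mathrm{QoI}(D)$, $h:\mathbb P\Rightarrow\mathrm{Id}$ means: some $P\in\mathbb P$ satisfies $h(d)=h(d')$ whenever $d\,P\,d'$ and both are defined. A mediator family is $g=\langle g_v:D\rightharpoonup\mathit{Val}\rangle_{v\in\mathit{Var}}$ of partial functions with a common domain; $\hat g(d)$ is the store with $v$-component $g_v(d)$. $g$ is legal for $\sigma$ when $g_v:\sigma(v)\Rightarrow\mathrm{Id}$ for every $v$. Universal objects. $\mathcal U_{\mathbb N}$ is the set of downsets of $(\mathbb N^{\mathit{Var}},\le)$ ordered by inclusion, with $\bigvee=\bigcup$, $\mathbb M\otimes\mathbb N={\downarrow}\{m+n\mid m\in\mathbb M,n\in\mathbb N\}$, $1={\downarrow}0$, generators $\hat v={\downarrow}e_v$ ($e_v$ the unit vector at $v$). $\mathcal U$ is the set of downsets of $(\mathcal P(\mathit{Var}),\subseteq)$ ordered by inclusion, with $\bigvee=\bigcup$, $\mathbb X\otimes\mathbb Y={\downarrow}\{X\cup Y\mid X\in\mathbb X,Y\in\mathbb Y\}$, $1={\downarrow}\emptyset$, generators $\hat v={\downarrow}\{v\}$.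 $\alpha^{\mathbb N}_\sigma(\mathbb M)=\bigvee_{m\in\mathbb M}\bigotimes_v\sigma(v)^{m(v)}$ and $\alpha_\sigma(\mathbb X)=\bigvee_{X\in\mathbb X}\bigotimes_{v\in X}\sigma(v)$. Typing rules (for each commutative complete quantale $M$). $\Gamma:\mathit{Var}\to M_1$, $p\in M_1$, $t_E(\Gamma)=\bigotimes_{v\in\mathit{fv}(E)}\Gamma(v)$. Derivability $p\vdash_M\Gamma\{C\}\Gamma'$ is generated by: (Skip) $p\vdash\Gamma\{\mathsf{skip}\}\Gamma$. (Assign) $p\vdash\Gamma\{x:=E\}\Gamma[x\mapsto p\otimes t_E(\Gamma)]$. (Seq) from $p\vdash\Gamma\{C_1\}\Gamma''$ and $p\vdash\Gamma''\{C_2\}\Gamma'$ infer $p\vdash\Gamma\{C_1;C_2\}\Gamma'$. (If) with $t=t_E(\Gamma)$, from $p\otimes t\vdash\Gamma\{C_i\}\Gamma_i'$ ($i=1,2$) infer $p\vdash\Gamma\{\mathsf{if}\;E\;C_1\;C_2\}\Gamma'$ where $\Gamma'(x)=t\otimes(\Gamma_1'(x)\vee\Gamma_2'(x))$ for $x\in\mathit{asgn}(C_1)\cup\mathit{asgn}(C_2)$ and $\Gamma'(x)=\Gamma(x)$ otherwise. (While) with $t=t_E(\Gamma)$, from $p\otimes t\vdash\Gamma\{C\}\Gamma$ infer $p\vdash\Gamma\{\mathsf{while}\;E\;C\}\Gamma^\dagger$ where $\Gamma^\dagger(x)=t^*\otimes\Gamma(x)$ for $x\in\mathit{asgn}(C)$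 and $\Gamma^\dagger(x)=\Gamma(x)$ otherwise. (Sub) from $p\vdash\Gamma\{C\}\Gamma_1'$, $p'\sqsubseteq p$, $\Gamma'\sqsubseteq\Gamma$, $\Gamma_1'\sqsubseteq\Gamma_2'$ infer $p'\vdash\Gamma'\{C\}\Gamma_2'$. Algorithmic system. $\mathcal A^C_M(p,\Gamma):\mathit{Var}\to M_1$ is defined by recursion on $C$: $\Gamma$ for $\mathsf{skip}$; $\Gamma[x\mapsto p\otimes t_E(\Gamma)]$ for $x:=E$; $\mathcal A^{C_2}(p,\mathcal A^{C_1}(p,\Gamma))$ for $C_1;C_2$; for $\mathsf{if}\;E\;C_1\;C_2$, with $t=t_E(\Gamma)$, $\Gamma_i'=\mathcal A^{C_i}(p\otimes t,\Gamma)$, the environment $x\mapsto t\otimes(\Gamma_1'(x)\vee\Gamma_2'(x))$ for $x\in\mathit{asgn}(C_1)\cup\mathit{asgn}(C_2)$ and $x\mapsto\Gamma(x)$ otherwise; for $\mathsf{while}\;E\;C$, with $\Gamma^*$ the least fixed point of $\Theta\mapsto\Gamma\vee\mathcal A^C(p\otimes t_E(\Theta),\Theta)$ and $t=t_E(\Gamma^* )$, the environment $x\mapsto t^*\otimes\Gamma^*(x)$ for $x\in\mathit{asgn}(C)$ and $x\mapsto\Gamma^*(x)$ otherwise. $\Delta_C=\mathcal A^C_{\mathcal U}(1,v\mapsto\hat v)$ and $\Delta^{\mathbb N}_C=\mathcal A^C_{\mathcal U_{\mathbb N}}(1,v\mapsto\hat v)$. Sound read-out for $\sigma$: a map $\beta:\mathcal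 U\to M$ such that for every $C$, $W$ and every $g$ legal for $\sigma$, $\pi_W\circ\llbracket C\rrbracket\circ\hat g:\beta(\mathbb J_W)\Rightarrow\mathrm{Id}$. Join-preserving means preserving arbitrary joins. Type object (renaming paradigm, over these rules): a commutative complete quantale $\mathcal V$, a map $\iota:\mathit{Var}\to\mathcal V_1$ and, for every $\sigma':\mathit{Var}\to M_1$, a map $h_{\sigma'}:\mathcal V\to M$ that is monotone, lax monoidal ($h(a)\otimes h(b)\sqsubseteq h(a\otimes b)$) and lax unital ($1\sqsubseteq h(1)$) with $h_{\sigma'}(\iota(v))\sqsupseteq\sigma'(v)$ for all $v$.
   Formalization: Equality is read as: both sides agree for all C and all W if and only if every σ(v) is idempotent. For one fixed C and W the "only if" fails (C = skip, W = ∅ gives 1 on both sides for any σ). D and Var are taken nonempty. *)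

theory Defs
  imports Main "HOL-Library.FuncSet"
begin

section \<open>Commutative complete quantales\<close>

text \<open>The tensor is written \<open>*\<close>, its unit \<open>1\<close>, the order \<open>\<le>\<close> and arbitrary joins
  \<open>Sup\<close>; hence the iterated tensors are \<open>prod\<close> and \<open>^\<close>.\<close>

class comm_quantale = complete_lattice + comm_monoid_mult +
  assumes Sup_mult: "Sup A * b = (SUP a\<in>A. a * b)"

lemma quantale_mult_mono:
  fixes a b c d :: "'m::comm_quantale"
  assumes "a \<le> b" "c \<le> d" shows "a * c \<le> b * d"
proof -
  have *: "x * z \<le> y * z" if "x \<le> y" for x y z :: 'm
  proof -
    have "y * z = sup (x * z) (y * z)"
      using Sup_mult[of "{x, y}" z] that by (simp add: sup_absorb2)
    thus ?thesis by (metis sup_ge1)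
  qed
  show ?thesis
    using *[OF assms(1), of c] *[OF assms(2), of b] by (simp add: mult.commute order_trans)
qed

definition star :: "'m::comm_quantale \<Rightarrow> 'm" where
  "star m = (SUP n. m ^ n)"

text \<open>Membership of an environment in \<open>Var \<rightarrow> M\<^sub>1\<close>.\<close>

definition env1 :: "('v \<Rightarrow> 'm::comm_quantale) \<Rightarrow> bool" where
  "env1 \<Gamma> \<longleftrightarrow> (\<forall>v. 1 \<le> \<Gamma> v)"


section \<open>The quantale of information\<close>

definition LoI :: "'d rel set" where
  "LoI = {P. equiv UNIV P}"

text \<open>A relation \<open>P\<close> lies below \<open>Q\<close> when \<open>Q \<subseteq> P\<close>, so the join of \<open>P\<close> and \<open>Q\<close> is
  \<open>P \<inter> Q\<close>, and the downset taken in \<open>tc\<close> consists of coarser relations.\<close>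

definition mix :: "'d rel set \<Rightarrow> 'd rel set" where
  "mix \<PP> = {Q \<in> LoI. \<forall>c \<in> UNIV // Q. \<exists>P\<in>\<PP>. c \<in> UNIV // P}"

definition tc :: "'d rel set \<Rightarrow> 'd rel set" where
  "tc \<PP> = {P \<in> LoI. \<exists>Q\<in>mix \<PP>. Q \<subseteq> P}"

definition joins :: "'d rel set \<Rightarrow> 'd rel set \<Rightarrow> 'd rel set" where
  "joins \<PP> \<QQ> = {P \<inter> Q | P Q. P \<in> \<PP> \<and> Q \<in> \<QQ>}"

lemma equiv_Int: "equiv UNIV P \<Longrightarrow> equiv UNIV Q \<Longrightarrow> equiv UNIV (P \<inter> Q)"
  using refl_on_Int[of UNIV P UNIV Q]
  by (auto intro!: equivI sym_Int trans_Int elim!: equivE)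

lemma mix_iff:
  "Q \<in> mix \<PP> \<longleftrightarrow> equiv UNIV Q \<and> (\<forall>x. \<exists>P\<in>\<PP>. Q `` {x} \<in> UNIV // P)"
  by (auto simp: mix_def LoI_def quotient_def)

lemma quotient_cell_iff:
  assumes "equiv UNIV P" "x \<in> c"
  shows "c \<in> UNIV // P \<longleftrightarrow> c = P `` {x}"
  using assms by (auto simp: quotient_def) (metis equiv_class_eq_iff Image_singleton_iff)+

lemma mix_cell:
  assumes "\<PP> \<subseteq> LoI"
  shows "Q \<in> mix \<PP> \<longleftrightarrow> equiv UNIV Q \<and> (\<forall>x. \<exists>P\<in>\<PP>. Q `` {x} = P `` {x})"
proof -
  have "Q `` {x} \<in> UNIV // P \<longleftrightarrow> Q `` {x} = P `` {x}" if "equiv UNIV Q" "P \<in> \<PP>" for x P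
    using quotient_cell_iff[of P x "Q `` {x}"] that assms
    by (auto simp: LoI_def dest: equiv_class_self)
  thus ?thesis unfolding mix_iff by blast
qed

lemma tc_LoI: "tc \<PP> \<subseteq> LoI"
  by (auto simp: tc_def)

lemma mix_mono: "\<PP> \<subseteq> \<QQ> \<Longrightarrow> mix \<PP> \<subseteq> mix \<QQ>"
  by (rule subsetI) (simp add: mix_iff, meson subsetD)

lemma tc_mono: "\<PP> \<subseteq> \<QQ> \<Longrightarrow> tc \<PP> \<subseteq> tc \<QQ>"
  unfolding tc_def by (rule subsetI) (simp, meson mix_mono subsetD)

lemma tc_ext: "\<PP> \<subseteq> LoI \<Longrightarrow> \<PP> \<subseteq> tc \<PP>"
  by (rule subsetI) (auto simp: tc_def mix_def)

lemma tcI: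
  assumes P: "equiv UNIV P" and PP: "\<PP> \<subseteq> LoI"
    and R: "\<And>c. c \<in> UNIV // P \<Longrightarrow> R c \<in> LoI"
    and sub: "\<And>c x. c \<in> UNIV // P \<Longrightarrow> x \<in> c \<Longrightarrow> R c `` {x} \<subseteq> c"
    and cell: "\<And>c x. c \<in> UNIV // P \<Longrightarrow> x \<in> c \<Longrightarrow> \<exists>Q\<in>\<PP>. R c `` {x} = Q `` {x}"
  shows "P \<in> tc \<PP>"
proof -
  define S where "S = {(x, y). (x, y) \<in> R (P `` {x})}"
  have q: "P `` {x} \<in> UNIV // P" for x by (simp add: quotientI)
  have self: "x \<in> P `` {x}" for x using P by (rule equiv_class_self) simp
  have S: "S `` {x} = R (P `` {x}) `` {x}" for x by (auto simp: S_def)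
  have SP: "S \<subseteq> P" using sub[OF q self] by (auto simp: S_def)
  have eqv: "equiv UNIV (R (P `` {x}))" for x using R[OF q] by (simp add: LoI_def)
  have cls: "P `` {x} = P `` {y}" if "(x, y) \<in> S" for x y
    using SP that P by (meson equiv_class_eq subsetD)
  have "equiv UNIV S"
  proof (rule equivI)
    show "refl_on UNIV S" using eqv by (auto simp: S_def refl_on_def equiv_def)
    show "sym S"
    proof (rule symI)
      fix x y assume s: "(x, y) \<in> S"
      hence "(y, x) \<in> R (P `` {x})" using eqv[of x] by (auto simp: S_def equiv_def sym_def)
      thus "(y, x) \<in> S" using cls[OF s] by (simp add: S_def)
    qed
    show "trans S"
    proof (rule transI)
      fix x y z assume s: "(x, y) \<in> S" "(y, z) \<in> S"
      hence "(x, y) \<in> R (P `` {x})" "(y, z) \<in> R (P `` {x})"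
        using cls[OF s(1)] by (auto simp: S_def)
      thus "(x, z) \<in> S" using eqv[of x] by (auto simp: S_def equiv_def trans_def)
    qed
  qed simp
  hence "S \<in> mix \<PP>" using cell[OF q self] by (simp add: mix_cell[OF PP] S)
  thus ?thesis using SP P by (auto simp: tc_def LoI_def)
qed

lemma tcE:
  assumes "P \<in> tc \<PP>" and "\<PP> \<subseteq> LoI"
  obtains Q where "equiv UNIV Q" "Q \<subseteq> P" "\<And>x. \<exists>P\<in>\<PP>. Q `` {x} = P `` {x}"
  using assms by (auto simp: tc_def mix_cell[OF assms(2)])

lemma tc_idem:
  assumes PP: "\<PP> \<subseteq> LoI" shows "tc (tc \<PP>) = tc \<PP>"
proof
  show "tc \<PP> \<subseteq> tc (tc \<PP>)" by (rule tc_ext[OF tc_LoI])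
  show "tc (tc \<PP>) \<subseteq> tc \<PP>"
  proof
    fix P assume P: "P \<in> tc (tc \<PP>)"
    then obtain Q where Q: "equiv UNIV Q" "Q \<subseteq> P" "\<And>x. \<exists>P\<in>tc \<PP>. Q `` {x} = P `` {x}"
      using tcE[OF P tc_LoI] by blast
    have "\<exists>R \<in> LoI. (\<forall>x\<in>c. R `` {x} \<subseteq> c) \<and> (\<forall>x. \<exists>P\<in>\<PP>. R `` {x} = P `` {x})"
      if cell: "c \<in> UNIV // Q" for c
    proof -
      obtain x where c: "c = Q `` {x}" using cell by (auto simp: quotient_def)
      obtain P' where P': "P' \<in> tc \<PP>" "c = P' `` {x}" using Q(3)[of x] c by blast
      obtain R where R: "equiv UNIV R" "R \<subseteq> P'" "\<And>x. \<exists>P\<in>\<PP>. R `` {x} = P `` {x}"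
        using tcE[OF P'(1) PP] by blast
      have "equiv UNIV P'" using P'(1) tc_LoI by (auto simp: LoI_def)
      hence "trans P'" by (rule equivE)
      hence "R `` {y} \<subseteq> c" if "y \<in> c" for y
        using R(2) P'(2) that by (blast dest: transD)
      thus ?thesis using R by (auto simp: LoI_def)
    qed
    then obtain R where R: "\<And>c. c \<in> UNIV // Q \<Longrightarrow>
        R c \<in> LoI \<and> (\<forall>x\<in>c. R c `` {x} \<subseteq> c) \<and> (\<forall>x. \<exists>P\<in>\<PP>. R c `` {x} = P `` {x})"
      by metis
    have "Q \<in> tc \<PP>" by (rule tcI[OF Q(1) PP, of R]) (use R in blast)+
    moreover have "equiv UNIV P" using P tc_LoI by (auto simp: LoI_def)
    ultimately show "P \<in> tc \<PP>" using Q(2) by (auto simp: tc_def LoI_def)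
  qed
qed

lemma joins_LoI: "\<PP> \<subseteq> LoI \<Longrightarrow> \<QQ> \<subseteq> LoI \<Longrightarrow> joins \<PP> \<QQ> \<subseteq> LoI"
  unfolding joins_def LoI_def using equiv_Int by blast

lemma joins_mono: "\<PP> \<subseteq> \<PP>' \<Longrightarrow> \<QQ> \<subseteq> \<QQ>' \<Longrightarrow> joins \<PP> \<QQ> \<subseteq> joins \<PP>' \<QQ>'"
  by (auto simp: joins_def)

lemma tc_joins:
  assumes "\<PP> \<subseteq> LoI" "\<QQ> \<subseteq> LoI"
  shows "tc (joins (tc \<PP>) (tc \<QQ>)) = tc (joins \<PP> \<QQ>)"
proof
  note J = joins_LoI[OF assms]
  show "tc (joins \<PP> \<QQ>) \<subseteq> tc (joins (tc \<PP>) (tc \<QQ>))"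
    by (intro tc_mono joins_mono tc_ext assms)
  have "joins (tc \<PP>) (tc \<QQ>) \<subseteq> tc (joins \<PP> \<QQ>)"
  proof
    fix R assume "R \<in> joins (tc \<PP>) (tc \<QQ>)"
    then obtain P Q where PQ: "R = P \<inter> Q" "P \<in> tc \<PP>" "Q \<in> tc \<QQ>" by (auto simp: joins_def)
    obtain P' where P': "equiv UNIV P'" "P' \<subseteq> P" "\<And>x. \<exists>P\<in>\<PP>. P' `` {x} = P `` {x}"
      using tcE[OF PQ(2) assms(1)] by blast
    obtain Q' where Q': "equiv UNIV Q'" "Q' \<subseteq> Q" "\<And>x. \<exists>P\<in>\<QQ>. Q' `` {x} = P `` {x}"
      using tcE[OF PQ(3) assms(2)] by blast
    have "\<exists>R\<in>joins \<PP> \<QQ>. (P' \<inter> Q') `` {x} = R `` {x}" for x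
    proof -
      obtain A B where "A \<in> \<PP>" "B \<in> \<QQ>" "P' `` {x} = A `` {x}" "Q' `` {x} = B `` {x}"
        using P'(3)[of x] Q'(3)[of x] by blast
      hence "A \<inter> B \<in> joins \<PP> \<QQ>" "(P' \<inter> Q') `` {x} = (A \<inter> B) `` {x}"
        by (auto simp: joins_def)
      thus ?thesis by blast
    qed
    hence "P' \<inter> Q' \<in> mix (joins \<PP> \<QQ>)"
      by (simp add: mix_cell[OF J] equiv_Int P' Q')
    moreover have "P \<inter> Q \<in> LoI"
      using PQ(2,3) unfolding tc_def LoI_def by (blast intro: equiv_Int)
    moreover have "P' \<inter> Q' \<subseteq> P \<inter> Q" using P'(2) Q'(2) by blast
    ultimately show "R \<in> tc (joins \<PP> \<QQ>)"
      unfolding PQ(1) tc_def by blast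
  qed
  hence "tc (joins (tc \<PP>) (tc \<QQ>)) \<subseteq> tc (tc (joins \<PP> \<QQ>))" by (rule tc_mono)
  thus "tc (joins (tc \<PP>) (tc \<QQ>)) \<subseteq> tc (joins \<PP> \<QQ>)" by (simp add: tc_idem[OF J])
qed

lemma tc_Union:
  assumes "\<And>A. A \<in> \<A> \<Longrightarrow> A \<subseteq> LoI"
  shows "tc (\<Union>(tc ` \<A>)) = tc (\<Union>\<A>)"
proof
  show "tc (\<Union>\<A>) \<subseteq> tc (\<Union>(tc ` \<A>))"
  proof (rule tc_mono)
    have "A \<subseteq> tc A" if "A \<in> \<A>" for A by (rule tc_ext) (rule assms[OF that])
    thus "\<Union>\<A> \<subseteq> \<Union>(tc ` \<A>)" by blast
  qed
  have "tc A \<subseteq> tc (\<Union>\<A>)" if "A \<in> \<A>" for A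
    by (rule tc_mono) (use that in blast)
  hence "tc (\<Union>(tc ` \<A>)) \<subseteq> tc (tc (\<Union>\<A>))" by (intro tc_mono) blast
  also have "\<dots> = tc (\<Union>\<A>)" by (rule tc_idem) (use assms in blast)
  finally show "tc (\<Union>(tc ` \<A>)) \<subseteq> tc (\<Union>\<A>)" .
qed

lemma tc_All: "tc {UNIV} = {UNIV :: 'd rel}"
proof -
  have All: "{UNIV :: 'd rel} \<subseteq> LoI"
    by (auto simp: LoI_def equiv_def refl_on_def sym_def trans_def)
  have "Q = UNIV" if "Q \<in> mix {UNIV :: 'd rel}" for Q
    using that by (auto simp: mix_cell[OF All])
  hence "tc {UNIV :: 'd rel} \<subseteq> {UNIV}" by (auto simp: tc_def)
  thus ?thesis using tc_ext[OF All] by blast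
qed

typedef 'd qoi = "{\<PP> :: 'd rel set. tc \<PP> = \<PP>}"
  by (intro exI CollectI) (rule tc_All)

setup_lifting type_definition_qoi

lemma qoi_LoI: "tc \<PP> = \<PP> \<Longrightarrow> \<PP> \<subseteq> LoI"
  by (metis tc_LoI)

instantiation qoi :: (type) comm_quantale
begin

lift_definition less_eq_qoi :: "'a qoi \<Rightarrow> 'a qoi \<Rightarrow> bool" is "(\<subseteq>)" .
lift_definition less_qoi :: "'a qoi \<Rightarrow> 'a qoi \<Rightarrow> bool" is "(\<subset>)" .
lift_definition Sup_qoi :: "'a qoi set \<Rightarrow> 'a qoi" is "\<lambda>\<A>. tc (\<Union>\<A>)"
  by (intro tc_idem Union_least qoi_LoI)
lift_definition Inf_qoi :: "'a qoi set \<Rightarrow> 'a qoi" is "\<lambda>\<A>. LoI \<inter> \<Inter>\<A>"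
proof -
  fix \<A> :: "'a rel set set" assume A: "\<And>x. x \<in> \<A> \<Longrightarrow> tc x = x"
  have "tc (LoI \<inter> \<Inter>\<A>) \<subseteq> X" if "X \<in> \<A>" for X
  proof -
    have "tc (LoI \<inter> \<Inter>\<A>) \<subseteq> tc X" by (rule tc_mono) (use that in auto)
    thus ?thesis by (simp add: A[OF that])
  qed
  hence "tc (LoI \<inter> \<Inter>\<A>) \<subseteq> LoI \<inter> \<Inter>\<A>"
    by (intro Int_greatest Inter_greatest tc_LoI)
  thus "tc (LoI \<inter> \<Inter>\<A>) = LoI \<inter> \<Inter>\<A>"
    by (rule subset_antisym) (simp add: tc_ext)
qed
lift_definition sup_qoi :: "'a qoi \<Rightarrow> 'a qoi \<Rightarrow> 'a qoi" is "\<lambda>\<PP> \<QQ>. tc (\<PP> \<union> \<QQ>)"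
  by (intro tc_idem Un_least qoi_LoI)
lift_definition inf_qoi :: "'a qoi \<Rightarrow> 'a qoi \<Rightarrow> 'a qoi" is "(\<inter>)"
proof -
  fix \<PP> \<QQ> :: "'a rel set" assume A: "tc \<PP> = \<PP>" "tc \<QQ> = \<QQ>"
  have "tc (\<PP> \<inter> \<QQ>) \<subseteq> \<PP> \<inter> \<QQ>"
    using tc_mono[of "\<PP> \<inter> \<QQ>" \<PP>] tc_mono[of "\<PP> \<inter> \<QQ>" \<QQ>] A by simp
  thus "tc (\<PP> \<inter> \<QQ>) = \<PP> \<inter> \<QQ>"
    by (rule subset_antisym) (rule tc_ext, rule le_infI1, rule qoi_LoI, rule A)
qed
lift_definition bot_qoi :: "'a qoi" is "tc {}" by (rule tc_idem) simp
lift_definition top_qoi :: "'a qoi" is LoI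
  by (rule subset_antisym[OF tc_LoI tc_ext]) simp
lift_definition one_qoi :: "'a qoi" is "{UNIV}" by (rule tc_All)
lift_definition times_qoi :: "'a qoi \<Rightarrow> 'a qoi \<Rightarrow> 'a qoi" is "\<lambda>\<PP> \<QQ>. tc (joins \<PP> \<QQ>)"
  by (intro tc_idem joins_LoI qoi_LoI)

instance
proof
  fix x y z :: "'a qoi" and A :: "'a qoi set"
  show "(x < y) = (x \<le> y \<and> \<not> y \<le> x)" by transfer auto
  show "x \<le> x" by transfer auto
  show "x \<le> y \<Longrightarrow> y \<le> z \<Longrightarrow> x \<le> z" by transfer auto
  show "x \<le> y \<Longrightarrow> y \<le> x \<Longrightarrow> x = y" by transfer auto
  show "inf x y \<le> x" "inf x y \<le> y" by (transfer, auto)+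
  show "x \<le> y \<Longrightarrow> x \<le> z \<Longrightarrow> x \<le> inf y z" by transfer auto
  show "x \<le> sup x y" "y \<le> sup x y" by (transfer, metis Un_upper1 Un_upper2 tc_mono)+
  show "y \<le> x \<Longrightarrow> z \<le> x \<Longrightarrow> sup y z \<le> x" by transfer (metis Un_least tc_mono)
  show "x \<in> A \<Longrightarrow> Inf A \<le> x" by transfer auto
  show "(\<And>x. x \<in> A \<Longrightarrow> z \<le> x) \<Longrightarrow> z \<le> Inf A"
    by transfer (rule Int_greatest, erule qoi_LoI, rule Inter_greatest, simp)
  show "x \<in> A \<Longrightarrow> x \<le> Sup A" by transfer (metis Union_upper tc_mono)
  show "(\<And>x. x \<in> A \<Longrightarrow> x \<le> z) \<Longrightarrow> Sup A \<le> z" by transfer (metis Union_least tc_mono)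
  show "Inf {} = (top :: 'a qoi)" by transfer simp
  show "Sup {} = (bot :: 'a qoi)" by transfer simp
  show "x * y = y * x" by transfer (auto simp: joins_def intro!: arg_cong[of _ _ tc])
  show "1 * x = x"
  proof transfer
    fix x :: "'a rel set" assume "tc x = x"
    moreover have "joins {UNIV} x = x" by (auto simp: joins_def)
    ultimately show "tc (joins {UNIV} x) = x" by simp
  qed
  show "x * y * z = x * (y * z)"
  proof transfer
    fix x y z :: "'a rel set" assume a: "tc x = x" "tc y = y" "tc z = z"
    note L = a[THEN qoi_LoI]
    have "tc (joins (tc (joins x y)) z) = tc (joins (joins x y) z)"
      using tc_joins[OF joins_LoI[OF L(1,2)] L(3)] a(3) by simp
    also have "joins (joins x y) z = joins x (joins y z)"
      unfolding joins_def by (auto simp: Int_assoc) (metis Int_assoc)+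
    also have "tc (joins x (joins y z)) = tc (joins x (tc (joins y z)))"
      using tc_joins[OF L(1) joins_LoI[OF L(2,3)]] a(1) by simp
    finally show "tc (joins (tc (joins x y)) z) = tc (joins x (tc (joins y z)))" .
  qed
  show "Sup A * y = (SUP a\<in>A. a * y)"
  proof transfer
    fix A :: "'a rel set set" and y :: "'a rel set"
    assume a: "\<forall>x\<in>A. tc x = x" "tc y = y"
    note L = a(1)[rule_format, THEN qoi_LoI] a(2)[THEN qoi_LoI]
    have "tc (joins (tc (\<Union>A)) y) = tc (joins (\<Union>A) y)"
      using tc_joins[of "\<Union>A" y, OF Union_least[OF L(1)] L(2)] a(2) by simp
    also have "joins (\<Union>A) y = \<Union>((\<lambda>x. joins x y) ` A)" by (auto simp: joins_def)
    also have "tc \<dots> = tc (\<Union>(tc ` (\<lambda>x. joins x y) ` A))"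
      by (rule tc_Union[symmetric]) (erule imageE, simp only:, rule joins_LoI[OF L(1) L(2)])
    finally show "tc (joins (tc (\<Union>A)) y) = tc (\<Union>((\<lambda>a. tc (joins a y)) ` A))"
      by (simp add: image_image)
  qed
qed

end


section \<open>Programs\<close>

text \<open>Expressions are left abstract: a language supplies their evaluation, their free variables,
  the two required families of expressions (variables and tuples of variables) and the test on
  values that decides guards.\<close>

record ('e, 'v, 'val) language =
  ev  :: "'e \<Rightarrow> ('v \<Rightarrow> 'val) \<Rightarrow> 'val"
  fv  :: "'e \<Rightarrow> 'v set"
  var :: "'v \<Rightarrow> 'e"
  tup :: "'v list \<Rightarrow> 'e"
  tst :: "'val \<Rightarrow> bool"

definition wf_language :: "('e, 'v, 'val) language \<Rightarrow> bool" where
  "wf_language L \<longleftrightarrow>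
     (\<forall>E s s'. (\<forall>v \<in> fv L E. s v = s' v) \<longrightarrow> ev L E s = ev L E s') \<and>
     (\<forall>v. fv L (var L v) = {v} \<and> (\<forall>s. ev L (var L v) s = s v)) \<and>
     (\<forall>vs. vs \<noteq> [] \<longrightarrow> fv L (tup L vs) = set vs \<and>
        (\<forall>s s'. ev L (tup L vs) s = ev L (tup L vs) s' \<longrightarrow> map s vs = map s' vs)) \<and>
     (\<exists>pair :: 'val \<times> 'val \<Rightarrow> 'val. inj pair)"

datatype ('v, 'e) com =
    Skip
  | Assign 'v 'e
  | Seq "('v, 'e) com" "('v, 'e) com"
  | If 'e "('v, 'e) com" "('v, 'e) com"
  | While 'e "('v, 'e) com"

primrec asgn :: "('v, 'e) com \<Rightarrow> 'v set" where
  "asgn Skip = {}"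
| "asgn (Assign x E) = {x}"
| "asgn (Seq C1 C2) = asgn C1 \<union> asgn C2"
| "asgn (If E C1 C2) = asgn C1 \<union> asgn C2"
| "asgn (While E C) = asgn C"

inductive exec :: "('e, 'v, 'val) language \<Rightarrow> ('v, 'e) com \<Rightarrow> ('v \<Rightarrow> 'val) \<Rightarrow> ('v \<Rightarrow> 'val) \<Rightarrow> bool"
  for L where
  Skip: "exec L Skip s s"
| Assign: "exec L (Assign x E) s (s(x := ev L E s))"
| Seq: "exec L C1 s s' \<Longrightarrow> exec L C2 s' s'' \<Longrightarrow> exec L (Seq C1 C2) s s''"
| IfTrue: "tst L (ev L E s) \<Longrightarrow> exec L C1 s s' \<Longrightarrow> exec L (If E C1 C2) s s'"
| IfFalse: "\<not> tst L (ev L E s) \<Longrightarrow> exec L C2 s s' \<Longrightarrow> exec L (If E C1 C2) s s'"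
| WhileTrue: "tst L (ev L E s) \<Longrightarrow> exec L C s s' \<Longrightarrow> exec L (While E C) s' s'' \<Longrightarrow>
    exec L (While E C) s s''"
| WhileFalse: "\<not> tst L (ev L E s) \<Longrightarrow> exec L (While E C) s s"

lemma exec_deterministic: "exec L C s s' \<Longrightarrow> exec L C s s'' \<Longrightarrow> s'' = s'"
proof (induction arbitrary: s'' rule: exec.induct)
  case (WhileTrue E s C s1 s2)
  from WhileTrue.prems WhileTrue.hyps(1) show ?case
    by (cases rule: exec.cases) (use WhileTrue.IH in auto)
next
  case (IfTrue E s C1 s' C2)
  from IfTrue.prems IfTrue.hyps(1) show ?case
    by (cases rule: exec.cases) (use IfTrue.IH in auto)
next
  case (IfFalse E s C2 s' C1)
  from IfFalse.prems IfFalse.hyps(1) show ?case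
    by (cases rule: exec.cases) (use IfFalse.IH in auto)
next
  case (Seq C1 s s1 C2 s2)
  from Seq.prems show ?case by (cases rule: exec.cases) (use Seq.IH in auto)
next
  case (WhileFalse E s C)
  from WhileFalse.prems WhileFalse.hyps show ?case by (cases rule: exec.cases) auto
qed (erule exec.cases; simp)+

definition sem :: "('e, 'v, 'val) language \<Rightarrow> ('v, 'e) com \<Rightarrow> ('v \<Rightarrow> 'val) \<rightharpoonup> ('v \<Rightarrow> 'val)" where
  "sem L C s = (if \<exists>s'. exec L C s s' then Some (THE s'. exec L C s s') else None)"


section \<open>Mediators\<close>

definition factors :: "('d \<rightharpoonup> 'a) \<Rightarrow> 'd qoi \<Rightarrow> bool" where
  "factors h \<PP> \<longleftrightarrow>
     (\<exists>P \<in> Rep_qoi \<PP>. \<forall>d d'. (d, d') \<in> P \<longrightarrow> h d \<noteq> None \<longrightarrow> h d' \<noteq> None \<longrightarrow> h d = h d')"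

definition mediator :: "('v \<Rightarrow> 'd \<rightharpoonup> 'val) \<Rightarrow> bool" where
  "mediator g \<longleftrightarrow> (\<forall>v v'. dom (g v) = dom (g v'))"

definition legal :: "('v \<Rightarrow> 'd qoi) \<Rightarrow> ('v \<Rightarrow> 'd \<rightharpoonup> 'val) \<Rightarrow> bool" where
  "legal \<sigma> g \<longleftrightarrow> (\<forall>v. factors (g v) (\<sigma> v))"

definition store_of :: "('v \<Rightarrow> 'd \<rightharpoonup> 'val) \<Rightarrow> 'd \<rightharpoonup> ('v \<Rightarrow> 'val)" where
  "store_of g d = (if \<forall>v. d \<in> dom (g v) then Some (\<lambda>v. the (g v d)) else None)"

definition observe ::
  "('e, 'v, 'val) language \<Rightarrow> ('v, 'e) com \<Rightarrow> 'v set \<Rightarrow> ('v \<Rightarrow> 'd \<rightharpoonup> 'val) \<Rightarrow> 'd \<rightharpoonup> ('v \<Rightarrow> 'val)" where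
  "observe L C W g d =
     map_option (\<lambda>s. restrict s W) (Option.bind (store_of g d) (sem L C))"


section \<open>Universal objects\<close>

definition down :: "'a::order set \<Rightarrow> 'a set" where
  "down A = {y. \<exists>x\<in>A. y \<le> x}"

lemma down_iff: "down A = A \<longleftrightarrow> (\<forall>x\<in>A. \<forall>y\<le>x. y \<in> A)"
  by (auto simp: down_def)

lemma down_Un: "down A = A \<Longrightarrow> down B = B \<Longrightarrow> down (A \<union> B) = A \<union> B"
  unfolding down_iff by blast

lemma down_Int: "down A = A \<Longrightarrow> down B = B \<Longrightarrow> down (A \<inter> B) = A \<inter> B"
  unfolding down_iff by blast

lemma down_down [simp]: "down (down A) = down A"
  by (auto simp: down_def intro: order_trans)

lemma in_down: "x \<in> A \<Longrightarrow> y \<le> x \<Longrightarrow> y \<in> down A"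
  by (auto simp: down_def)

lemma down_Sup: "(\<And>x. x \<in> A \<Longrightarrow> down x = x) \<Longrightarrow> down (\<Union>A) = \<Union>A"
  unfolding down_iff by (meson UnionE UnionI)

lemma down_Inf: "(\<And>x. x \<in> A \<Longrightarrow> down x = x) \<Longrightarrow> down (\<Inter>A) = \<Inter>A"
  unfolding down_iff by (meson InterD InterI)

typedef 'v setU = "{\<XX> :: 'v set set. down \<XX> = \<XX>}"
  by (rule exI[of _ "{}"]) (simp add: down_def)

setup_lifting type_definition_setU

typedef 'v natU = "{\<MM> :: ('v \<Rightarrow> nat) set. down \<MM> = \<MM>}"
  by (rule exI[of _ "{}"]) (simp add: down_def)

setup_lifting type_definition_natU

instantiation setU :: (type) comm_quantale
begin

lift_definition less_eq_setU :: "'a setU \<Rightarrow> 'a setU \<Rightarrow> bool" is "(\<subseteq>)" .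
lift_definition less_setU :: "'a setU \<Rightarrow> 'a setU \<Rightarrow> bool" is "(\<subset>)" .
lift_definition Sup_setU :: "'a setU set \<Rightarrow> 'a setU" is Union by (rule down_Sup)
lift_definition Inf_setU :: "'a setU set \<Rightarrow> 'a setU" is Inter by (rule down_Inf)
lift_definition sup_setU :: "'a setU \<Rightarrow> 'a setU \<Rightarrow> 'a setU" is "(\<union>)" by (rule down_Un)
lift_definition inf_setU :: "'a setU \<Rightarrow> 'a setU \<Rightarrow> 'a setU" is "(\<inter>)" by (rule down_Int)
lift_definition bot_setU :: "'a setU" is "{}" by (simp add: down_def)
lift_definition top_setU :: "'a setU" is UNIV by (auto simp: down_def)
lift_definition one_setU :: "'a setU" is "down {{}}" by simp
lift_definition times_setU :: "'a setU \<Rightarrow> 'a setU \<Rightarrow> 'a setU"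
  is "\<lambda>\<XX> \<YY>. down {X \<union> Y | X Y. X \<in> \<XX> \<and> Y \<in> \<YY>}" by simp

instance
proof
  fix x y z :: "'a setU" and A :: "'a setU set"
  show "(x < y) = (x \<le> y \<and> \<not> y \<le> x)" by transfer auto
  show "x \<le> x" by transfer auto
  show "x \<le> y \<Longrightarrow> y \<le> z \<Longrightarrow> x \<le> z" by transfer auto
  show "x \<le> y \<Longrightarrow> y \<le> x \<Longrightarrow> x = y" by transfer auto
  show "inf x y \<le> x" "inf x y \<le> y" by (transfer, auto)+
  show "x \<le> y \<Longrightarrow> x \<le> z \<Longrightarrow> x \<le> inf y z" by transfer auto
  show "x \<le> sup x y" "y \<le> sup x y" by (transfer, auto)+
  show "y \<le> x \<Longrightarrow> z \<le> x \<Longrightarrow> sup y z \<le> x" by transfer auto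
  show "x \<in> A \<Longrightarrow> Inf A \<le> x" by transfer auto
  show "(\<And>x. x \<in> A \<Longrightarrow> z \<le> x) \<Longrightarrow> z \<le> Inf A" by transfer blast
  show "x \<in> A \<Longrightarrow> x \<le> Sup A" by transfer auto
  show "(\<And>x. x \<in> A \<Longrightarrow> x \<le> z) \<Longrightarrow> Sup A \<le> z" by transfer blast
  show "Inf {} = (top :: 'a setU)" by transfer simp
  show "Sup {} = (bot :: 'a setU)" by transfer simp
  show "x * y = y * x"
    by transfer (rule arg_cong[of _ _ down], auto)
  show "1 * x = x"
    by transfer (fastforce simp: down_def)
  show "x * y * z = x * (y * z)"
  proof transfer
    fix x y z :: "'a set set"
    let ?T = "\<lambda>A B. {X \<union> Y | X Y. X \<in> A \<and> Y \<in> B}"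
    have "down (?T (down (?T x y)) z) = down {X \<union> Y \<union> Z | X Y Z. X \<in> x \<and> Y \<in> y \<and> Z \<in> z}"
      unfolding down_def by (auto, (meson order_trans Un_mono order_refl | blast)+)
    also have "\<dots> = down (?T x (down (?T y z)))"
      unfolding down_def by (auto simp: Un_assoc, (meson order_trans Un_mono order_refl | blast)+)
    finally show "down (?T (down (?T x y)) z) = down (?T x (down (?T y z)))" .
  qed
  show "Sup A * y = (SUP a\<in>A. a * y)"
    by transfer (auto simp: down_def)
qed

end

instantiation natU :: (type) comm_quantale
begin

lift_definition less_eq_natU :: "'a natU \<Rightarrow> 'a natU \<Rightarrow> bool" is "(\<subseteq>)" .
lift_definition less_natU :: "'a natU \<Rightarrow> 'a natU \<Rightarrow> bool" is "(\<subset>)" .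
lift_definition Sup_natU :: "'a natU set \<Rightarrow> 'a natU" is Union by (rule down_Sup)
lift_definition Inf_natU :: "'a natU set \<Rightarrow> 'a natU" is Inter by (rule down_Inf)
lift_definition sup_natU :: "'a natU \<Rightarrow> 'a natU \<Rightarrow> 'a natU" is "(\<union>)" by (rule down_Un)
lift_definition inf_natU :: "'a natU \<Rightarrow> 'a natU \<Rightarrow> 'a natU" is "(\<inter>)" by (rule down_Int)
lift_definition bot_natU :: "'a natU" is "{}" by (simp add: down_def)
lift_definition top_natU :: "'a natU" is UNIV by (auto simp: down_def)
lift_definition one_natU :: "'a natU" is "down {\<lambda>v. 0}" by simp
lift_definition times_natU :: "'a natU \<Rightarrow> 'a natU \<Rightarrow> 'a natU"
  is "\<lambda>\<MM> \<NN>. down {(\<lambda>v. m v + n v) | m n. m \<in> \<MM> \<and> n \<in> \<NN>}" by simp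

instance
proof
  fix x y z :: "'a natU" and A :: "'a natU set"
  show "(x < y) = (x \<le> y \<and> \<not> y \<le> x)" by transfer auto
  show "x \<le> x" by transfer auto
  show "x \<le> y \<Longrightarrow> y \<le> z \<Longrightarrow> x \<le> z" by transfer auto
  show "x \<le> y \<Longrightarrow> y \<le> x \<Longrightarrow> x = y" by transfer auto
  show "inf x y \<le> x" "inf x y \<le> y" by (transfer, auto)+
  show "x \<le> y \<Longrightarrow> x \<le> z \<Longrightarrow> x \<le> inf y z" by transfer auto
  show "x \<le> sup x y" "y \<le> sup x y" by (transfer, auto)+
  show "y \<le> x \<Longrightarrow> z \<le> x \<Longrightarrow> sup y z \<le> x" by transfer auto
  show "x \<in> A \<Longrightarrow> Inf A \<le> x" by transfer auto
  show "(\<And>x. x \<in> A \<Longrightarrow> z \<le> x) \<Longrightarrow> z \<le> Inf A" by transfer blast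
  show "x \<in> A \<Longrightarrow> x \<le> Sup A" by transfer auto
  show "(\<And>x. x \<in> A \<Longrightarrow> x \<le> z) \<Longrightarrow> Sup A \<le> z" by transfer blast
  show "Inf {} = (top :: 'a natU)" by transfer simp
  show "Sup {} = (bot :: 'a natU)" by transfer simp
  show "x * y = y * x"
    by transfer (rule arg_cong[of _ _ down], auto,
        (rule_tac x = n in exI, rule_tac x = m in exI, simp add: add.commute)+)
  show "1 * x = x"
    by transfer (fastforce simp: down_def le_fun_def)
  show "x * y * z = x * (y * z)"
  proof transfer
    fix x y z :: "('a \<Rightarrow> nat) set"
    let ?T = "\<lambda>A B. {(\<lambda>v. m v + n v) | m n :: 'a \<Rightarrow> nat. m \<in> A \<and> n \<in> B}"
    let ?T3 = "{(\<lambda>v. k v + m v + n v) | k m n. k \<in> x \<and> m \<in> y \<and> n \<in> z}"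
    have "down (?T (down (?T x y)) z) = down ?T3"
    proof (intro equalityI subsetI)
      fix f assume "f \<in> down (?T (down (?T x y)) z)"
      then obtain p n k m where h: "f \<le> (\<lambda>v. p v + n v)" "n \<in> z" "k \<in> x" "m \<in> y"
        "p \<le> (\<lambda>v. k v + m v)" by (auto simp: down_def)
      have "f \<le> (\<lambda>v. k v + m v + n v)"
        using h(1,5) by (fastforce simp: le_fun_def intro: order_trans)
      thus "f \<in> down ?T3" using h by (intro in_down[of "\<lambda>v. k v + m v + n v"]) auto
    next
      fix f assume "f \<in> down ?T3"
      then obtain k m n where h: "f \<le> (\<lambda>v. k v + m v + n v)" "k \<in> x" "m \<in> y" "n \<in> z"
        by (auto simp: down_def)
      have "(\<lambda>v. k v + m v) \<in> down (?T x y)" using h by (intro in_down[OF _ order_refl]) auto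
      thus "f \<in> down (?T (down (?T x y)) z)" using h
        by (intro in_down[of "\<lambda>v. (k v + m v) + n v"]) auto
    qed
    also have "down ?T3 = down (?T x (down (?T y z)))"
    proof (intro equalityI subsetI)
      fix f assume "f \<in> down (?T x (down (?T y z)))"
      then obtain p n k m where h: "f \<le> (\<lambda>v. k v + p v)" "n \<in> z" "k \<in> x" "m \<in> y"
        "p \<le> (\<lambda>v. m v + n v)" by (auto simp: down_def)
      have "f \<le> (\<lambda>v. k v + m v + n v)"
        using h(1,5) by (fastforce simp: le_fun_def add.assoc intro: order_trans)
      thus "f \<in> down ?T3" using h by (intro in_down[of "\<lambda>v. k v + m v + n v"]) auto
    next
      fix f assume "f \<in> down ?T3"
      then obtain k m n where h: "f \<le> (\<lambda>v. k v + m v + n v)" "k \<in> x" "m \<in> y" "n \<in> z"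
        by (auto simp: down_def)
      have "(\<lambda>v. m v + n v) \<in> down (?T y z)" using h by (intro in_down[OF _ order_refl]) auto
      hence "(\<lambda>v. k v + (m v + n v)) \<in> ?T x (down (?T y z))"
        using h(2) by (intro CollectI exI conjI) auto
      thus "f \<in> down (?T x (down (?T y z)))" using h
        by (intro in_down[of "\<lambda>v. k v + (m v + n v)"]) (auto simp: add.assoc)
    qed
    finally show "down (?T (down (?T x y)) z) = down (?T x (down (?T y z)))" .
  qed
  show "Sup A * y = (SUP a\<in>A. a * y)"
    by transfer (auto simp: down_def)
qed

end

lift_definition set_gen :: "'v \<Rightarrow> 'v setU" is "\<lambda>v. down {{v}}" by simp

lift_definition nat_gen :: "'v \<Rightarrow> 'v natU" is "\<lambda>v. down {\<lambda>u. if u = v then 1 else 0}" by simp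

definition set_ext :: "('v::finite \<Rightarrow> 'm::comm_quantale) \<Rightarrow> 'v setU \<Rightarrow> 'm"  (\<open>\<alpha>\<close>) where
  "\<alpha> \<sigma> \<XX> = (SUP X \<in> Rep_setU \<XX>. \<Prod>v\<in>X. \<sigma> v)"

definition nat_ext :: "('v::finite \<Rightarrow> 'm::comm_quantale) \<Rightarrow> 'v natU \<Rightarrow> 'm"  (\<open>\<alpha>\<^sub>\<nat>\<close>) where
  "\<alpha>\<^sub>\<nat> \<sigma> \<MM> = (SUP m \<in> Rep_natU \<MM>. \<Prod>v\<in>UNIV. \<sigma> v ^ m v)"


section \<open>Typing\<close>

definition tE :: "('e, 'v::finite, 'val) language \<Rightarrow> 'e \<Rightarrow> ('v \<Rightarrow> 'm::comm_quantale) \<Rightarrow> 'm" where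
  "tE L E \<Gamma> = (\<Prod>v \<in> fv L E. \<Gamma> v)"

text \<open>The side conditions \<open>1 \<le> p\<close> and \<open>env1 \<Gamma>\<close> keep every label and environment of a derivation
  in \<open>M\<^sub>1\<close>.\<close>

inductive typing ::
  "('e, 'v::finite, 'val) language \<Rightarrow> 'm::comm_quantale \<Rightarrow> ('v \<Rightarrow> 'm) \<Rightarrow> ('v, 'e) com \<Rightarrow> ('v \<Rightarrow> 'm) \<Rightarrow> bool"
  for L where
  Skip: "1 \<le> p \<Longrightarrow> env1 \<Gamma> \<Longrightarrow> typing L p \<Gamma> Skip \<Gamma>"
| Assign: "1 \<le> p \<Longrightarrow> env1 \<Gamma> \<Longrightarrow> typing L p \<Gamma> (Assign x E) (\<Gamma>(x := p * tE L E \<Gamma>))"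
| Seq: "typing L p \<Gamma> C1 \<Gamma>'' \<Longrightarrow> typing L p \<Gamma>'' C2 \<Gamma>' \<Longrightarrow> typing L p \<Gamma> (Seq C1 C2) \<Gamma>'"
| If: "1 \<le> p \<Longrightarrow> t = tE L E \<Gamma> \<Longrightarrow>
    typing L (p * t) \<Gamma> C1 \<Gamma>1 \<Longrightarrow> typing L (p * t) \<Gamma> C2 \<Gamma>2 \<Longrightarrow>
    typing L p \<Gamma> (If E C1 C2)
      (\<lambda>x. if x \<in> asgn C1 \<union> asgn C2 then t * sup (\<Gamma>1 x) (\<Gamma>2 x) else \<Gamma> x)"
| While: "1 \<le> p \<Longrightarrow> t = tE L E \<Gamma> \<Longrightarrow> typing L (p * t) \<Gamma> C \<Gamma> \<Longrightarrow>
    typing L p \<Gamma> (While E C) (\<lambda>x. if x \<in> asgn C then star t * \<Gamma> x else \<Gamma> x)"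
| Sub: "typing L p \<Gamma> C \<Gamma>1 \<Longrightarrow> 1 \<le> p' \<Longrightarrow> env1 \<Gamma>' \<Longrightarrow> p' \<le> p \<Longrightarrow> \<Gamma>' \<le> \<Gamma> \<Longrightarrow> \<Gamma>1 \<le> \<Gamma>2 \<Longrightarrow>
    typing L p' \<Gamma>' C \<Gamma>2"

text \<open>The fixed point for loops is taken in the complete lattice of all environments \<open>Var \<rightarrow> M\<close>.
  It exists by lemma \<open>alg_mono\<close> below, and as it lies above \<open>\<Gamma>\<close> it is also the least one among
  environments \<open>Var \<rightarrow> M\<^sub>1\<close>.\<close>

primrec alg ::
  "('e, 'v::finite, 'val) language \<Rightarrow> ('v, 'e) com \<Rightarrow> 'm::comm_quantale \<Rightarrow> ('v \<Rightarrow> 'm) \<Rightarrow> ('v \<Rightarrow> 'm)" where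
  "alg L Skip p \<Gamma> = \<Gamma>"
| "alg L (Assign x E) p \<Gamma> = \<Gamma>(x := p * tE L E \<Gamma>)"
| "alg L (Seq C1 C2) p \<Gamma> = alg L C2 p (alg L C1 p \<Gamma>)"
| "alg L (If E C1 C2) p \<Gamma> =
    (let t = tE L E \<Gamma>; \<Gamma>1 = alg L C1 (p * t) \<Gamma>; \<Gamma>2 = alg L C2 (p * t) \<Gamma>
     in (\<lambda>x. if x \<in> asgn C1 \<union> asgn C2 then t * sup (\<Gamma>1 x) (\<Gamma>2 x) else \<Gamma> x))"
| "alg L (While E C) p \<Gamma> =
    (let \<Gamma>s = lfp (\<lambda>\<Theta>. sup \<Gamma> (alg L C (p * tE L E \<Theta>) \<Theta>)); t = tE L E \<Gamma>s
     in (\<lambda>x. if x \<in> asgn C then star t * \<Gamma>s x else \<Gamma>s x))"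

lemma quantale_prod_mono:
  fixes f g :: "'a \<Rightarrow> 'm::comm_quantale"
  assumes "\<And>x. x \<in> A \<Longrightarrow> f x \<le> g x"
  shows "prod f A \<le> prod g A"
  using assms by (induction A rule: infinite_finite_induct) (auto intro: quantale_mult_mono)

lemma tE_mono: "\<Gamma> \<le> \<Gamma>' \<Longrightarrow> tE L E \<Gamma> \<le> tE L E \<Gamma>'"
  unfolding tE_def by (rule quantale_prod_mono) (simp add: le_fun_def)

lemma star_mono: "t \<le> t' \<Longrightarrow> star t \<le> star t'"
proof -
  assume "t \<le> t'"
  hence "t ^ n \<le> t' ^ n" for n by (induction n) (auto intro: quantale_mult_mono)
  thus ?thesis unfolding star_def by (blast intro: SUP_mono)
qed

lemma alg_mono:
  "p \<le> p' \<Longrightarrow> \<Gamma> \<le> \<Gamma>' \<Longrightarrow> alg L C p \<Gamma> \<le> alg L C p' \<Gamma>'"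
proof (induction C arbitrary: p p' \<Gamma> \<Gamma>')
  case (Assign x E)
  thus ?case by (auto simp: le_fun_def intro!: quantale_mult_mono tE_mono[unfolded le_fun_def])
next
  case (If E C1 C2)
  note t = tE_mono[OF If.prems(2), of L E]
  note pt = quantale_mult_mono[OF If.prems(1) t]
  show ?case
    using If.IH[OF pt If.prems(2), THEN le_funD] If.prems(2) t
    by (auto simp: Let_def le_fun_def intro!: quantale_mult_mono sup_mono)
next
  case (While E C)
  let ?f = "\<lambda>p \<Gamma> \<Theta>. sup \<Gamma> (alg L C (p * tE L E \<Theta>) \<Theta>)"
  have g: "lfp (?f p \<Gamma>) \<le> lfp (?f p' \<Gamma>')"
    by (intro lfp_mono sup_mono While.IH quantale_mult_mono While.prems order_refl)
  note s = star_mono[OF tE_mono[OF g, of L E]]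
  show ?case using g s by (auto simp: Let_def le_fun_def intro!: quantale_mult_mono)
qed auto

definition set_type :: "('e, 'v::finite, 'val) language \<Rightarrow> ('v, 'e) com \<Rightarrow> 'v \<Rightarrow> 'v setU" where
  "set_type L C = alg L C 1 set_gen"

definition nat_type :: "('e, 'v::finite, 'val) language \<Rightarrow> ('v, 'e) com \<Rightarrow> 'v \<Rightarrow> 'v natU" where
  "nat_type L C = alg L C 1 nat_gen"

definition set_joint :: "('e, 'v::finite, 'val) language \<Rightarrow> ('v, 'e) com \<Rightarrow> 'v set \<Rightarrow> 'v setU"  (\<open>\<J>\<close>) where
  "\<J> L C W = (\<Prod>w\<in>W. set_type L C w)"

definition nat_joint :: "('e, 'v::finite, 'val) language \<Rightarrow> ('v, 'e) com \<Rightarrow> 'v set \<Rightarrow> 'v natU"  (\<open>\<J>\<^sub>\<nat>\<close>) where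
  "\<J>\<^sub>\<nat> L C W = (\<Prod>w\<in>W. nat_type L C w)"


section \<open>Read-outs and type objects\<close>

definition sound_readout ::
  "('e, 'v::finite, 'val) language \<Rightarrow> ('v \<Rightarrow> 'd qoi) \<Rightarrow> ('v setU \<Rightarrow> 'd qoi) \<Rightarrow> bool" where
  "sound_readout L \<sigma> \<beta> \<longleftrightarrow>
     (\<forall>C W g. mediator g \<longrightarrow> legal \<sigma> g \<longrightarrow> factors (observe L C W g) (\<beta> (\<J> L C W)))"

definition join_preserving :: "('a::complete_lattice \<Rightarrow> 'b::complete_lattice) \<Rightarrow> bool" where
  "join_preserving f \<longleftrightarrow> (\<forall>A. f (Sup A) = Sup (f ` A))"

definition type_object ::
  "('v \<Rightarrow> 'q::comm_quantale) \<Rightarrow> (('v \<Rightarrow> 'm::comm_quantale) \<Rightarrow> 'q \<Rightarrow> 'm) \<Rightarrow> bool" where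
  "type_object \<iota> h \<longleftrightarrow>
     env1 \<iota> \<and>
     (\<forall>\<sigma>. env1 \<sigma> \<longrightarrow>
        mono (h \<sigma>) \<and>
        (\<forall>a b. h \<sigma> a * h \<sigma> b \<le> h \<sigma> (a * b)) \<and>
        1 \<le> h \<sigma> 1 \<and>
        (\<forall>v. \<sigma> v \<le> h \<sigma> (\<iota> v)))"

end

theory Submission
  imports Defs
begin

text \<open>Let \<open>J\<close> be the tensor, over \<open>W\<close>, of the labels which the algorithmic system computes directly
  in \<open>QoI(D)\<close> from \<open>\<sigma>\<close>. The algorithmic system commutes laxly with lax monotone maps and oplaxly with
  oplax join-preserving maps. The multiset extension is a homomorphism, so the ceiling equals \<open>J\<close>;
  the set extension is always oplax, so the floor is at most \<open>J\<close>, and it is lax when the labels are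
  idempotent. A branch on \<open>v\<close> that reassigns \<open>v\<close> to itself charges \<open>v\<close> three times in the ceiling and
  once in the floor, which gives the converse. For soundness of the set extension, a legal mediator
  only uses one witness \<open>P\<^sub>v \<in> \<sigma>(v)\<close> per variable, and the principal labels generated by these witnesses
  are idempotent, so that noninterference for types in \<open>QoI(D)\<close> applies.\<close>


section \<open>Algorithmic types along lax maps\<close>

definition lax :: "('m::comm_quantale \<Rightarrow> 'n::comm_quantale) \<Rightarrow> bool" where
  "lax h \<longleftrightarrow> mono h \<and> (\<forall>a b. h a * h b \<le> h (a * b)) \<and> 1 \<le> h 1"

text \<open>Join preservation, rather than mere monotonicity, is demanded here because the loop case
  below needs a right adjoint of \<open>h\<close>.\<close>

definition oplax :: "('m::comm_quantale \<Rightarrow> 'n::comm_quantale) \<Rightarrow> bool" where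
  "oplax h \<longleftrightarrow> join_preserving h \<and> (\<forall>a b. h (a * b) \<le> h a * h b) \<and> h 1 \<le> 1"

lemma lax_mult:
  assumes "lax h" "a' \<le> h a" "b' \<le> h b"
  shows "a' * b' \<le> h (a * b)"
  using assms quantale_mult_mono[of a' "h a" b' "h b"] unfolding lax_def by (meson order_trans)

lemma oplax_mult:
  assumes "oplax h" "h a \<le> a'" "h b \<le> b'"
  shows "h (a * b) \<le> a' * b'"
  using assms quantale_mult_mono[of "h a" a' "h b" b'] unfolding oplax_def by (meson order_trans)

lemma lax_prod:
  assumes "lax h" "\<And>x. x \<in> A \<Longrightarrow> f' x \<le> h (f x)"
  shows "prod f' A \<le> h (prod f A)"
  using assms(2)
  by (induction A rule: infinite_finite_induct)
    (use assms(1) in \<open>auto intro: lax_mult simp: lax_def\<close>)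

lemma oplax_prod:
  assumes "oplax h" "\<And>x. x \<in> A \<Longrightarrow> h (f x) \<le> f' x"
  shows "h (prod f A) \<le> prod f' A"
  using assms(2)
  by (induction A rule: infinite_finite_induct)
    (use assms(1) in \<open>auto intro: oplax_mult simp: oplax_def\<close>)

lemma lax_tE:
  assumes "lax h" "\<And>v. \<Gamma>' v \<le> h (\<Gamma> v)"
  shows "tE L E \<Gamma>' \<le> h (tE L E \<Gamma>)"
  unfolding tE_def by (rule lax_prod[OF assms])

lemma oplax_tE:
  assumes "oplax h" "\<And>v. h (\<Gamma> v) \<le> \<Gamma>' v"
  shows "h (tE L E \<Gamma>) \<le> tE L E \<Gamma>'"
  unfolding tE_def by (rule oplax_prod[OF assms])

lemma lax_sup: "lax h \<Longrightarrow> a' \<le> h a \<Longrightarrow> b' \<le> h b \<Longrightarrow> sup a' b' \<le> h (sup a b)"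
  unfolding lax_def by (meson le_supI monoD order_trans sup_ge1 sup_ge2)

lemma join_preserving_sup: "join_preserving h \<Longrightarrow> h (sup a b) = sup (h a) (h b)"
  unfolding join_preserving_def by (drule spec[of _ "{a, b}"]) simp

lemma join_preserving_SUP: "join_preserving h \<Longrightarrow> h (SUP i\<in>I. f i) = (SUP i\<in>I. h (f i))"
  by (simp add: join_preserving_def image_image)

lemma join_preserving_mono: "join_preserving h \<Longrightarrow> mono h"
  by (rule monoI) (metis join_preserving_sup le_iff_sup)

lemma oplax_sup: "oplax h \<Longrightarrow> h a \<le> a' \<Longrightarrow> h b \<le> b' \<Longrightarrow> h (sup a b) \<le> sup a' b'"
  unfolding oplax_def by (simp add: join_preserving_sup sup.coboundedI1 sup.coboundedI2)

lemma lax_star: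
  assumes "lax h" "t' \<le> h t"
  shows "star t' \<le> h (star t)"
proof -
  have "t' ^ n \<le> h (t ^ n)" for n
    by (induction n) (use assms in \<open>auto intro: lax_mult simp: lax_def\<close>)
  moreover have "h (t ^ n) \<le> h (star t)" for n
    using assms(1) unfolding lax_def star_def by (meson UNIV_I SUP_upper monoD)
  ultimately show ?thesis
    unfolding star_def[of t'] by (blast intro: SUP_least order_trans)
qed

lemma oplax_star:
  assumes "oplax h" "h t \<le> t'"
  shows "h (star t) \<le> star t'"
proof -
  have "h (t ^ n) \<le> t' ^ n" for n
    by (induction n) (use assms in \<open>auto intro: oplax_mult simp: oplax_def\<close>)
  thus ?thesis
    using assms(1) unfolding star_def oplax_def by (simp add: join_preserving_SUP SUP_mono')
qed

text \<open>Naming the loop functional lets its monotonicity and fixed-point equations be used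
  without unfolding. For this reason \<open>alg_While\<close> takes the place of the defining
  equation, which leaves the simpset.\<close>

definition loop_step ::
  "('e, 'v::finite, 'val) language \<Rightarrow> 'e \<Rightarrow> ('v, 'e) com \<Rightarrow> 'm::comm_quantale \<Rightarrow> ('v \<Rightarrow> 'm) \<Rightarrow> ('v \<Rightarrow> 'm) \<Rightarrow> ('v \<Rightarrow> 'm)" where
  "loop_step L E C p \<Gamma> \<Theta> = sup \<Gamma> (alg L C (p * tE L E \<Theta>) \<Theta>)"

lemma mono_loop_step: "mono (loop_step L E C p \<Gamma>)"
  unfolding loop_step_def
  by (intro monoI sup_mono order_refl alg_mono quantale_mult_mono tE_mono)

lemma alg_While:
  "alg L (While E C) p \<Gamma> =
    (let \<Gamma>s = lfp (loop_step L E C p \<Gamma>); t = tE L E \<Gamma>s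
     in (\<lambda>x. if x \<in> asgn C then star t * \<Gamma>s x else \<Gamma>s x))"
  by (simp add: loop_step_def[abs_def])

declare alg.simps(5) [simp del]

text \<open>Induction on the command. All cases but the loop combine the lax inequalities for
  tensor, join and star.\<close>

lemma lax_alg:
  assumes h: "lax h"
  shows "p' \<le> h p \<Longrightarrow> (\<And>v. \<Gamma>' v \<le> h (\<Gamma> v)) \<Longrightarrow> alg L C p' \<Gamma>' x \<le> h (alg L C p \<Gamma> x)"
proof (induction C arbitrary: p p' \<Gamma> \<Gamma>' x)
  case (Assign y E)
  thus ?case by (auto intro!: lax_mult[OF h] lax_tE[OF h])
next
  case (If E C1 C2)
  note t = lax_tE[OF h If.prems(2), of L E]
  note pt = lax_mult[OF h If.prems(1) t]
  show ?case
    using If.IH[OF pt If.prems(2)] If.prems(2) t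
    by (auto simp: Let_def intro!: lax_mult[OF h] lax_sup[OF h])
next
  case (While E C)
  let ?F = "loop_step L E C p \<Gamma>" and ?F' = "loop_step L E C p' \<Gamma>'"
  \<comment> \<open>By the induction hypothesis, the image under \<open>h\<close> of the source
    fixed point is a prefixed point of the target functional, so the least one lies below
    it.\<close>
  have "?F' (\<lambda>v. h (lfp ?F v)) \<le> (\<lambda>v. h (lfp ?F v))"
  proof (rule le_funI)
    fix v
    have "?F' (\<lambda>v. h (lfp ?F v)) v \<le> h (?F (lfp ?F) v)"
      unfolding loop_step_def sup_apply
      by (rule lax_sup[OF h While.prems(2) While.IH])
        (auto intro: lax_mult[OF h While.prems(1)] lax_tE[OF h])
    thus "?F' (\<lambda>v. h (lfp ?F v)) v \<le> h (lfp ?F v)"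
      by (simp flip: lfp_unfold[OF mono_loop_step])
  qed
  hence *: "lfp ?F' v \<le> h (lfp ?F v)" for v
    by (rule lfp_lowerbound[THEN le_funD])
  show ?case
    unfolding alg_While Let_def
    by (auto intro: * lax_mult[OF h] lax_star[OF h] lax_tE[OF h])
qed auto

text \<open>In the loop case the image of a least fixed point has to be bounded from above. Join
  preservation makes this possible: the target fixed point is pulled back along the right adjoint to
  a prefixed point of the source functional.\<close>

lemma oplax_alg:
  assumes h: "oplax h"
  shows "h p \<le> p' \<Longrightarrow> (\<And>v. h (\<Gamma> v) \<le> \<Gamma>' v) \<Longrightarrow> h (alg L C p \<Gamma> x) \<le> alg L C p' \<Gamma>' x"
proof (induction C arbitrary: p p' \<Gamma> \<Gamma>' x)
  case (Assign y E)
  thus ?case by (auto intro!: oplax_mult[OF h] oplax_tE[OF h])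
next
  case (If E C1 C2)
  note t = oplax_tE[OF h If.prems(2), of L E]
  note pt = oplax_mult[OF h If.prems(1) t]
  show ?case
    using If.IH[OF pt If.prems(2)] If.prems(2) t
    by (auto simp: Let_def intro!: oplax_mult[OF h] oplax_sup[OF h])
next
  case (While E C)
  let ?F = "loop_step L E C p \<Gamma>" and ?F' = "loop_step L E C p' \<Gamma>'"
  \<comment> \<open>Fixed-point fusion: \<open>U\<close> is the image of \<open>lfp ?F'\<close> under the right adjoint of \<open>h\<close>.\<close>
  define U where "U v = Sup {a. h a \<le> lfp ?F' v}" for v
  have jp: "join_preserving h" using h by (simp add: oplax_def)
  have U: "h (U v) \<le> lfp ?F' v" for v
    using jp unfolding U_def join_preserving_def by (auto intro: Sup_least)
  have "?F U \<le> U"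
  proof (rule le_funI)
    fix v
    have "h (?F U v) \<le> ?F' (lfp ?F') v"
      unfolding loop_step_def[of L E C p \<Gamma>] loop_step_def[of L E C p' \<Gamma>' "lfp _"] sup_apply
      by (rule oplax_sup[OF h While.prems(2) While.IH])
        (auto intro: U oplax_mult[OF h While.prems(1)] oplax_tE[OF h])
    hence "h (?F U v) \<le> lfp ?F' v"
      by (simp flip: lfp_unfold[OF mono_loop_step])
    thus "?F U v \<le> U v" unfolding U_def by (blast intro: Sup_upper)
  qed
  hence "lfp ?F v \<le> U v" for v by (rule lfp_lowerbound[THEN le_funD])
  hence *: "h (lfp ?F v) \<le> lfp ?F' v" for v
    using U join_preserving_mono[OF jp] by (meson monoD order_trans)
  show ?case
    unfolding alg_While Let_def
    by (auto intro: * oplax_mult[OF h] oplax_star[OF h] oplax_tE[OF h])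
qed auto

text \<open>Subsumption is absorbed by monotonicity of \<open>alg\<close>, and the invariant of a
  derived loop is itself a prefixed point of the loop functional.\<close>

lemma alg_le_typing: "typing L p \<Gamma> C \<Gamma>' \<Longrightarrow> alg L C p \<Gamma> \<le> \<Gamma>'"
proof (induction rule: typing.induct)
  case (Seq p \<Gamma> C1 \<Gamma>'' C2 \<Gamma>')
  thus ?case using alg_mono[OF order_refl Seq.IH(1)] by (auto intro: order_trans)
next
  case (If p t E \<Gamma> C1 \<Gamma>1 C2 \<Gamma>2)
  thus ?case by (auto simp: Let_def le_fun_def intro!: quantale_mult_mono sup_mono)
next
  case (While p t E \<Gamma> C)
  have *: "lfp (loop_step L E C p \<Gamma>) \<le> \<Gamma>"
    by (rule lfp_lowerbound) (use While in \<open>simp add: loop_step_def\<close>)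
  have "star (tE L E (lfp (loop_step L E C p \<Gamma>))) \<le> star t"
    unfolding While by (intro star_mono tE_mono *)
  with * show ?case
    unfolding alg_While Let_def by (auto simp: le_fun_def intro!: quantale_mult_mono)
next
  case (Sub p \<Gamma> C \<Gamma>1 p' \<Gamma>' \<Gamma>2)
  thus ?case using alg_mono[of p' p \<Gamma>' \<Gamma> L C] by (auto intro: order_trans)
qed auto


section \<open>The extensions of a labelling\<close>

lemma SUP_mult:
  fixes f :: "'a \<Rightarrow> 'm::comm_quantale"
  shows "(SUP a\<in>A. f a) * b = (SUP a\<in>A. f a * b)"
  by (simp add: Sup_mult image_image)

lemma mult_SUP:
  fixes f :: "'a \<Rightarrow> 'm::comm_quantale"
  shows "b * (SUP a\<in>A. f a) = (SUP a\<in>A. b * f a)"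
  by (simp add: mult.commute[of b] SUP_mult)

lemma one_le_prod:
  fixes f :: "'a \<Rightarrow> 'm::comm_quantale"
  shows "(\<And>x. x \<in> A \<Longrightarrow> 1 \<le> f x) \<Longrightarrow> 1 \<le> prod f A"
  using quantale_prod_mono[of A "\<lambda>_. 1" f] by simp

lemma prod_subset_mono:
  fixes f :: "'a::finite \<Rightarrow> 'm::comm_quantale"
  assumes "env1 f" "A \<subseteq> B"
  shows "prod f A \<le> prod f B"
proof -
  have "prod f A * 1 \<le> prod f A * prod f (B - A)"
    by (intro quantale_mult_mono order_refl one_le_prod) (use assms in \<open>simp add: env1_def\<close>)
  thus ?thesis using assms(2) by (simp add: prod.subset_diff[of A B] mult.commute)
qed

lemma power_mono_exponent:
  fixes a :: "'m::comm_quantale"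
  assumes "1 \<le> a" "m \<le> n"
  shows "a ^ m \<le> a ^ n"
  using assms(2)
proof (induction rule: dec_induct)
  case (step n)
  thus ?case using quantale_mult_mono[OF assms(1), of "a ^ n" "a ^ n"] by auto
qed simp

section \<open>The set extension: oplax always, lax for idempotent labels\<close>

lemma join_preserving_set_ext: "join_preserving (\<alpha> \<sigma>)"
  unfolding join_preserving_def set_ext_def
  by (auto simp: Sup_setU.rep_eq intro!: antisym SUP_least SUP_upper2 intro: Sup_upper)

lemma Rep_setU_mult_iff:
  "Z \<in> Rep_setU (a * b) \<longleftrightarrow> (\<exists>X\<in>Rep_setU a. \<exists>Y\<in>Rep_setU b. Z \<subseteq> X \<union> Y)"
  by (auto simp: times_setU.rep_eq down_def)

lemma oplax_set_ext:
  assumes "env1 \<sigma>"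
  shows "oplax (\<alpha> \<sigma>)"
proof -
  have "\<alpha> \<sigma> (a * b) \<le> \<alpha> \<sigma> a * \<alpha> \<sigma> b" for a b
    unfolding set_ext_def[of \<sigma> "a * b"]
  proof (rule SUP_least)
    fix Z assume "Z \<in> Rep_setU (a * b)"
    then obtain X Y where XY: "X \<in> Rep_setU a" "Y \<in> Rep_setU b" "Z \<subseteq> X \<union> Y"
      by (auto simp: Rep_setU_mult_iff)
    \<comment> \<open>A variable shared by \<open>X\<close> and \<open>Y\<close> is charged to
      \<open>X\<close> only. The tensor charges it twice, and labels above 1 make the second charge
      an increase.\<close>
    have "prod \<sigma> Z \<le> prod \<sigma> (X \<union> (Y - X))"
      by (rule prod_subset_mono[OF assms]) (use XY in auto)
    also have "\<dots> = prod \<sigma> X * prod \<sigma> (Y - X)"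
      by (rule prod.union_disjoint) auto
    also have "\<dots> \<le> \<alpha> \<sigma> a * \<alpha> \<sigma> b"
    proof (rule quantale_mult_mono)
      have "prod \<sigma> (Y - X) \<le> prod \<sigma> Y" by (rule prod_subset_mono[OF assms]) auto
      also have "\<dots> \<le> \<alpha> \<sigma> b" unfolding set_ext_def by (rule SUP_upper[OF XY(2)])
      finally show "prod \<sigma> (Y - X) \<le> \<alpha> \<sigma> b" .
      show "prod \<sigma> X \<le> \<alpha> \<sigma> a" unfolding set_ext_def by (rule SUP_upper[OF XY(1)])
    qed
    finally show "prod \<sigma> Z \<le> \<alpha> \<sigma> a * \<alpha> \<sigma> b" .
  qed
  moreover have "\<alpha> \<sigma> 1 \<le> 1"
    by (auto simp: set_ext_def one_setU.rep_eq down_def)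
  ultimately show ?thesis
    by (simp add: oplax_def join_preserving_set_ext)
qed

lemma lax_set_ext:
  assumes "env1 \<sigma>" "\<And>v. \<sigma> v * \<sigma> v = \<sigma> v"
  shows "lax (\<alpha> \<sigma>)"
proof -
  have "\<alpha> \<sigma> a * \<alpha> \<sigma> b \<le> \<alpha> \<sigma> (a * b)" for a b
    unfolding set_ext_def[of \<sigma> a] set_ext_def[of \<sigma> b] SUP_mult mult_SUP
  proof (intro SUP_least)
    fix X Y assume XY: "X \<in> Rep_setU a" "Y \<in> Rep_setU b"
    \<comment> \<open>Both factors are raised to the union, so that idempotence collapses the square
      factor by factor.\<close>
    have "prod \<sigma> X * prod \<sigma> Y \<le> prod \<sigma> (X \<union> Y) * prod \<sigma> (X \<union> Y)"
      by (intro quantale_mult_mono prod_subset_mono assms(1)) auto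
    also have "\<dots> = prod \<sigma> (X \<union> Y)"
      by (simp add: assms(2) flip: prod.distrib)
    also have "\<dots> \<le> \<alpha> \<sigma> (a * b)"
      unfolding set_ext_def by (rule SUP_upper) (use XY in \<open>auto simp: Rep_setU_mult_iff\<close>)
    finally show "prod \<sigma> X * prod \<sigma> Y \<le> \<alpha> \<sigma> (a * b)" .
  qed
  moreover have "1 \<le> \<alpha> \<sigma> 1"
    unfolding set_ext_def one_setU.rep_eq by (rule SUP_upper2[of "{}"]) (auto simp: down_def)
  ultimately show ?thesis
    by (simp add: lax_def join_preserving_mono[OF join_preserving_set_ext])
qed

lemma set_ext_gen:
  assumes "env1 \<sigma>"
  shows "\<alpha> \<sigma> (set_gen v) = \<sigma> v"
proof (rule antisym)
  show "\<alpha> \<sigma> (set_gen v) \<le> \<sigma> v"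
    unfolding set_ext_def set_gen.rep_eq
    using prod_subset_mono[OF assms, of _ "{v}"] by (auto simp: down_def intro!: SUP_least)
  show "\<sigma> v \<le> \<alpha> \<sigma> (set_gen v)"
    unfolding set_ext_def set_gen.rep_eq
    by (rule SUP_upper2[of "{v}"]) (auto simp: down_def)
qed

section \<open>The multiset extension as a homomorphism\<close>

lemma join_preserving_nat_ext: "join_preserving (\<alpha>\<^sub>\<nat> \<sigma>)"
  unfolding join_preserving_def nat_ext_def
  by (auto simp: Sup_natU.rep_eq intro!: antisym SUP_least SUP_upper2 intro: Sup_upper)

abbreviation monomial :: "('v::finite \<Rightarrow> 'm::comm_quantale) \<Rightarrow> ('v \<Rightarrow> nat) \<Rightarrow> 'm" where
  "monomial \<sigma> m \<equiv> \<Prod>v\<in>UNIV. \<sigma> v ^ m v"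

lemma monomial_mono: "env1 \<sigma> \<Longrightarrow> m \<le> n \<Longrightarrow> monomial \<sigma> m \<le> monomial \<sigma> n"
  by (auto simp: env1_def le_fun_def intro!: quantale_prod_mono power_mono_exponent)

text \<open>Monomials grow with their exponents because the labels lie above 1, so the join over a
  downset may be taken over its generators.\<close>

lemma nat_ext_down:
  assumes "env1 \<sigma>" "Rep_natU M = down A"
  shows "\<alpha>\<^sub>\<nat> \<sigma> M = (SUP m\<in>A. monomial \<sigma> m)"
  unfolding nat_ext_def assms(2)
  by (rule antisym)
    (auto simp: down_def intro!: SUP_least intro: SUP_upper SUP_upper2 monomial_mono[OF assms(1)])

text \<open>Exponents add, so a shared variable keeps its multiplicity, and the equality holds
  without idempotence of the labels.\<close>

lemma nat_ext_mult:
  assumes "env1 \<sigma>"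
  shows "\<alpha>\<^sub>\<nat> \<sigma> (a * b) = \<alpha>\<^sub>\<nat> \<sigma> a * \<alpha>\<^sub>\<nat> \<sigma> b"
proof -
  have "\<alpha>\<^sub>\<nat> \<sigma> (a * b) =
      (SUP k\<in>{\<lambda>v. m v + n v | m n. m \<in> Rep_natU a \<and> n \<in> Rep_natU b}. monomial \<sigma> k)"
    by (rule nat_ext_down[OF assms times_natU.rep_eq])
  also have "\<dots> = (SUP n\<in>Rep_natU b. SUP m\<in>Rep_natU a. monomial \<sigma> m * monomial \<sigma> n)"
    by (rule antisym)
      (fastforce simp: power_add prod.distrib intro!: SUP_least
        intro: SUP_upper2 order_refl)+
  also have "\<dots> = \<alpha>\<^sub>\<nat> \<sigma> a * \<alpha>\<^sub>\<nat> \<sigma> b"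
    by (simp only: nat_ext_def SUP_mult mult_SUP)
  finally show ?thesis .
qed

lemma nat_ext_one: "env1 \<sigma> \<Longrightarrow> \<alpha>\<^sub>\<nat> \<sigma> 1 = 1"
  by (simp add: nat_ext_down[OF _ one_natU.rep_eq])

lemma nat_ext_gen:
  assumes "env1 \<sigma>"
  shows "\<alpha>\<^sub>\<nat> \<sigma> (nat_gen v) = \<sigma> v"
proof -
  have "\<sigma> u ^ (if u = v then 1 else 0) = (if u = v then \<sigma> u else 1)" for u by simp
  thus ?thesis by (simp add: nat_ext_down[OF assms nat_gen.rep_eq])
qed

lemma lax_nat_ext: "env1 \<sigma> \<Longrightarrow> lax (\<alpha>\<^sub>\<nat> \<sigma>)"
  by (simp add: lax_def nat_ext_mult nat_ext_one join_preserving_mono[OF join_preserving_nat_ext])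

lemma oplax_nat_ext: "env1 \<sigma> \<Longrightarrow> oplax (\<alpha>\<^sub>\<nat> \<sigma>)"
  by (simp add: oplax_def nat_ext_mult nat_ext_one join_preserving_nat_ext)

section \<open>Floor and ceiling compared with the labels computed directly from \<sigma>\<close>

definition joint ::
  "('e, 'v::finite, 'val) language \<Rightarrow> ('v, 'e) com \<Rightarrow> ('v \<Rightarrow> 'm::comm_quantale) \<Rightarrow> 'v set \<Rightarrow> 'm" where
  "joint L C \<sigma> W = (\<Prod>w\<in>W. alg L C 1 \<sigma> w)"

lemma set_joint_eq: "\<J> L C W = joint L C set_gen W"
  by (simp add: set_joint_def joint_def set_type_def)

lemma nat_joint_eq: "\<J>\<^sub>\<nat> L C W = joint L C nat_gen W"
  by (simp add: nat_joint_def joint_def nat_type_def)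

lemma lax_joint:
  assumes "lax h" "\<And>v. \<sigma> v \<le> h (\<tau> v)"
  shows "joint L C \<sigma> W \<le> h (joint L C \<tau> W)"
  unfolding joint_def
  by (intro lax_prod lax_alg assms) (use assms(1) in \<open>simp add: lax_def\<close>)

lemma oplax_joint:
  assumes "oplax h" "\<And>v. h (\<tau> v) \<le> \<sigma> v"
  shows "h (joint L C \<tau> W) \<le> joint L C \<sigma> W"
  unfolding joint_def
  by (intro oplax_prod oplax_alg assms) (use assms(1) in \<open>simp add: oplax_def\<close>)

lemma set_ext_joint_le: "env1 \<sigma> \<Longrightarrow> \<alpha> \<sigma> (\<J> L C W) \<le> joint L C \<sigma> W"
  unfolding set_joint_eq by (rule oplax_joint[OF oplax_set_ext]) (simp_all add: set_ext_gen)

lemma joint_le_set_ext: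
  assumes "env1 \<sigma>" "\<And>v. \<sigma> v * \<sigma> v = \<sigma> v"
  shows "joint L C \<sigma> W \<le> \<alpha> \<sigma> (\<J> L C W)"
  unfolding set_joint_eq by (rule lax_joint[OF lax_set_ext[OF assms]]) (simp add: set_ext_gen[OF assms(1)])

text \<open>The multiset extension is both lax and oplax and sends generators to labels, so it
  commutes with the algorithmic system exactly.\<close>

lemma nat_ext_joint: "env1 \<sigma> \<Longrightarrow> \<alpha>\<^sub>\<nat> \<sigma> (\<J>\<^sub>\<nat> L C W) = joint L C \<sigma> W"
  unfolding nat_joint_eq
  by (rule antisym)
    (auto intro: oplax_joint oplax_nat_ext lax_joint lax_nat_ext simp: nat_ext_gen)

text \<open>The ceiling is the value computed directly from \<sigma>. Laxness of
  \<open>h \<sigma>\<close> puts it below the image of the algorithmic type over \<iota>, which lies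
  below every derivable \<Delta>.\<close>

lemma typing_ceiling:
  assumes "env1 \<sigma>" "type_object \<iota> h" "typing L 1 \<iota> C \<Delta>"
  shows "\<alpha>\<^sub>\<nat> \<sigma> (\<J>\<^sub>\<nat> L C W) \<le> h \<sigma> (\<Prod>w\<in>W. \<Delta> w)"
proof -
  have h: "lax (h \<sigma>)" "\<And>v. \<sigma> v \<le> h \<sigma> (\<iota> v)"
    using assms(1,2) by (auto simp: type_object_def lax_def)
  have "joint L C \<iota> W \<le> (\<Prod>w\<in>W. \<Delta> w)"
    unfolding joint_def using alg_le_typing[OF assms(3)]
    by (auto intro: quantale_prod_mono simp: le_fun_def)
  hence "h \<sigma> (joint L C \<iota> W) \<le> h \<sigma> (\<Prod>w\<in>W. \<Delta> w)"
    using h(1) by (simp add: lax_def monoD)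
  thus ?thesis
    unfolding nat_ext_joint[OF assms(1)] by (rule order_trans[OF lax_joint[OF h]])
qed

lemma idempotent_of_ext_eq:
  assumes "wf_language L" "env1 \<sigma>" "\<And>C W. \<alpha> \<sigma> (\<J> L C W) = \<alpha>\<^sub>\<nat> \<sigma> (\<J>\<^sub>\<nat> L C W)"
  shows "\<sigma> v * \<sigma> v = \<sigma> v"
proof -
  let ?C = "If (var L v) (Assign v (var L v)) (Assign v (var L v))"
  have one: "1 \<le> \<sigma> v" using assms(2) by (simp add: env1_def)
  have fv: "fv L (var L v) = {v}" using assms(1) by (simp add: wf_language_def)
  \<comment> \<open>The three factors are the guard's charge on the result of the branch, the raised
    program counter, and the assigned expression.\<close>
  have cube: "alg L ?C 1 \<tau> v = \<tau> v * (\<tau> v * \<tau> v)" for \<tau> :: "_ \<Rightarrow> 'z::comm_quantale"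
    by (simp add: Let_def tE_def fv)
  have idem: "x * (x * x) = x" if "x = set_gen v" for x
    unfolding that by transfer (auto simp: down_def, blast+)
  have "\<J> L ?C {v} = set_gen v"
    by (simp add: set_joint_eq joint_def cube idem del: alg.simps(4))
  hence "\<sigma> v = joint L ?C \<sigma> {v}"
    using assms(3)[of ?C "{v}"] by (simp only: set_ext_gen[OF assms(2)] nat_ext_joint[OF assms(2)])
  also have "\<dots> = \<sigma> v * (\<sigma> v * \<sigma> v)" by (simp add: joint_def cube del: alg.simps(4))
  finally have eq: "\<sigma> v = \<sigma> v * (\<sigma> v * \<sigma> v)" .
  \<comment> \<open>Since the label is above 1 and equals its cube, its square is squeezed between
    the two.\<close>
  have "\<sigma> v * \<sigma> v \<le> \<sigma> v * (\<sigma> v * \<sigma> v)"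
    using quantale_mult_mono[OF one order_refl, of "\<sigma> v * \<sigma> v"] by simp
  moreover have "\<sigma> v \<le> \<sigma> v * \<sigma> v"
    using quantale_mult_mono[OF one order_refl, of "\<sigma> v"] by simp
  ultimately show ?thesis using eq by (simp add: antisym)
qed

section \<open>Noninterference in the quantale of information\<close>

lemma tc_Rep_qoi [simp]: "tc (Rep_qoi q) = Rep_qoi q"
  using Rep_qoi[of q] by simp

lemma Rep_qoi_LoI: "Rep_qoi q \<subseteq> LoI"
  by (rule qoi_LoI) simp

lemma Rep_qoi_equiv: "P \<in> Rep_qoi q \<Longrightarrow> equiv UNIV P"
  using Rep_qoi_LoI by (auto simp: LoI_def)

lemma qoi_mem_mono: "a \<le> b \<Longrightarrow> P \<in> Rep_qoi a \<Longrightarrow> P \<in> Rep_qoi b"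
  by (auto simp: less_eq_qoi.rep_eq)

lemma Rep_qoi_coarser:
  assumes "P \<in> Rep_qoi q" "P \<subseteq> Q" "equiv UNIV Q"
  shows "Q \<in> Rep_qoi q"
proof -
  have "P \<in> mix (Rep_qoi q)"
    unfolding mix_cell[OF Rep_qoi_LoI] using assms(1) Rep_qoi_equiv by blast
  hence "Q \<in> tc (Rep_qoi q)"
    unfolding tc_def LoI_def using assms(2,3) by blast
  thus ?thesis by simp
qed

lemma equiv_UNIV: "equiv UNIV (UNIV :: 'd rel)"
  by (auto simp: equiv_def refl_on_def sym_def trans_def)

lemma one_le_qoi_iff: "1 \<le> q \<longleftrightarrow> UNIV \<in> Rep_qoi q"
  by (simp add: less_eq_qoi.rep_eq one_qoi.rep_eq)

lemma UNIV_in_qoi: "P \<in> Rep_qoi q \<Longrightarrow> UNIV \<in> Rep_qoi q"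
  by (rule Rep_qoi_coarser[OF _ subset_UNIV equiv_UNIV])

lemma equiv_INT:
  assumes "\<And>w. w \<in> A \<Longrightarrow> equiv UNIV (f w)"
  shows "equiv UNIV (\<Inter>w\<in>A. f w)"
proof (rule equivI)
  have *: "refl (f w)" "sym (f w)" "trans (f w)" if "w \<in> A" for w
    using assms[OF that] by (auto elim: equivE)
  show "refl (\<Inter>w\<in>A. f w)" using *(1) by (auto intro!: refl_onI dest: refl_onD)
  show "sym (\<Inter>w\<in>A. f w)" using *(2) by (auto intro!: symI dest: symD)
  show "trans (\<Inter>w\<in>A. f w)" by (rule transI) (use *(3) in \<open>auto dest: transD\<close>)
qed simp

lemma INT_Rep_qoi_equiv:
  "(\<And>w. w \<in> A \<Longrightarrow> f w \<in> Rep_qoi (\<sigma> w)) \<Longrightarrow> equiv UNIV (\<Inter>w\<in>A. f w)"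
  by (rule equiv_INT) (rule Rep_qoi_equiv)

lemma INT_Rep_qoi_LoI: "{\<Inter>w\<in>A. f w | f. \<forall>w\<in>A. f w \<in> Rep_qoi (\<sigma> w)} \<subseteq> LoI"
  by (auto simp: LoI_def intro!: INT_Rep_qoi_equiv)

text \<open>An iterated tensor needs a single closure at the end, because \<open>tc_joins\<close>
  removes the inner ones. Its generators are intersections of one witness per factor.\<close>

lemma Rep_qoi_prod:
  assumes "finite A"
  shows "Rep_qoi (prod \<sigma> A) = tc {\<Inter>w\<in>A. f w | f. \<forall>w\<in>A. f w \<in> Rep_qoi (\<sigma> w)}"
  using assms
proof (induction A)
  case empty
  show ?case by (simp add: one_qoi.rep_eq tc_All)
next
  case (insert x A)
  let ?S = "\<lambda>A. {\<Inter>w\<in>A. f w | f. \<forall>w\<in>A. f w \<in> Rep_qoi (\<sigma> w)}"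
  have "joins (Rep_qoi (\<sigma> x)) (?S A) = ?S (insert x A)"
  proof (intro equalityI subsetI)
    fix R assume "R \<in> joins (Rep_qoi (\<sigma> x)) (?S A)"
    then obtain P f where P: "R = P \<inter> (\<Inter>w\<in>A. f w)" "P \<in> Rep_qoi (\<sigma> x)" "\<forall>w\<in>A. f w \<in> Rep_qoi (\<sigma> w)"
      unfolding joins_def by blast
    \<comment> \<open>Storing \<open>P\<close> at \<open>x\<close> leaves the choices on
      \<open>A\<close> intact because \<open>x\<close> is not in \<open>A\<close>.\<close>
    have f: "(f(x := P)) w = f w" if "w \<in> A" for w
      using insert.hyps that by auto
    have "R = (\<Inter>w\<in>insert x A. (f(x := P)) w)"
      unfolding P(1) INF_insert using f by simp
    moreover have "\<forall>w\<in>insert x A. (f(x := P)) w \<in> Rep_qoi (\<sigma> w)"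
      using P(2,3) f by simp
    ultimately show "R \<in> ?S (insert x A)" by blast
  next
    fix R assume "R \<in> ?S (insert x A)"
    then obtain f where "R = f x \<inter> (\<Inter>w\<in>A. f w)" "f x \<in> Rep_qoi (\<sigma> x)" "\<forall>w\<in>A. f w \<in> Rep_qoi (\<sigma> w)"
      by auto
    thus "R \<in> joins (Rep_qoi (\<sigma> x)) (?S A)" unfolding joins_def by blast
  qed
  thus ?case
    using tc_joins[OF Rep_qoi_LoI INT_Rep_qoi_LoI, of "\<sigma> x" A \<sigma>]
    unfolding prod.insert[OF insert.hyps] times_qoi.rep_eq insert.IH tc_Rep_qoi by (simp only:)
qed

lemma INT_in_prod_qoi:
  assumes "finite A" "\<And>w. w \<in> A \<Longrightarrow> f w \<in> Rep_qoi (\<sigma> w)"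
  shows "(\<Inter>w\<in>A. f w) \<in> Rep_qoi (prod \<sigma> A)"
  unfolding Rep_qoi_prod[OF assms(1)]
  by (rule subsetD[OF tc_ext[OF INT_Rep_qoi_LoI]]) (use assms(2) in blast)

lemma prod_qoi_le:
  assumes "finite A"
    and "\<And>f. (\<And>w. w \<in> A \<Longrightarrow> f w \<in> Rep_qoi (\<sigma> w)) \<Longrightarrow> (\<Inter>w\<in>A. f w) \<in> Rep_qoi q"
  shows "prod \<sigma> A \<le> q"
proof -
  have "{\<Inter>w\<in>A. f w | f. \<forall>w\<in>A. f w \<in> Rep_qoi (\<sigma> w)} \<subseteq> Rep_qoi q"
    using assms(2) by blast
  from tc_mono[OF this] show ?thesis
    by (simp add: less_eq_qoi.rep_eq Rep_qoi_prod[OF assms(1)])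
qed

text \<open>Mixing at work: the witness \<open>R d\<close> may change from one cell of
  \<open>T\<close> to the next. The glued relation has at \<open>x\<close> the cell of
  \<open>T \<inter> R x\<close>, and constancy of \<open>R\<close> on cells of \<open>T\<close>
  makes it an equivalence.\<close>

lemma cellwise_in_mult_qoi:
  assumes T: "T \<in> Rep_qoi t" and R: "\<And>d. R d \<in> Rep_qoi q"
    and const: "\<And>d d'. (d, d') \<in> T \<Longrightarrow> R d = R d'"
  shows "{(d, d'). (d, d') \<in> T \<and> (d, d') \<in> R d} \<in> Rep_qoi (t * q)" (is "?S \<in> _")
proof -
  note eT = Rep_qoi_equiv[OF T] and eR = Rep_qoi_equiv[OF R]
  have J: "joins (Rep_qoi t) (Rep_qoi q) \<subseteq> LoI"
    by (intro joins_LoI Rep_qoi_LoI)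
  have "equiv UNIV ?S"
  proof (rule equivI)
    show "refl_on UNIV ?S" using eT eR by (auto simp: equiv_def refl_on_def)
    show "sym ?S"
    proof (rule symI, clarify)
      fix x y assume "(x, y) \<in> T" "(x, y) \<in> R x"
      moreover have "R y = R x" using const[OF \<open>(x, y) \<in> T\<close>] by simp
      ultimately show "(y, x) \<in> T \<and> (y, x) \<in> R y"
        using eT eR[of x] unfolding equiv_def by (metis symD)
    qed
    show "trans ?S"
    proof (rule transI, clarify)
      fix x y z assume "(x, y) \<in> T" "(x, y) \<in> R x" "(y, z) \<in> T" "(y, z) \<in> R y"
      moreover have "R y = R x" using const[OF \<open>(x, y) \<in> T\<close>] by simp
      ultimately show "(x, z) \<in> T \<and> (x, z) \<in> R x"
        using eT eR[of x] unfolding equiv_def by (metis transD)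
    qed
  qed simp
  moreover have "\<exists>P\<in>joins (Rep_qoi t) (Rep_qoi q). ?S `` {x} = P `` {x}" for x
    by (rule bexI[of _ "T \<inter> R x"]) (use T R in \<open>auto simp: joins_def\<close>)
  ultimately have "?S \<in> mix (joins (Rep_qoi t) (Rep_qoi q))"
    by (simp add: mix_cell[OF J])
  thus ?thesis
    by (auto simp: times_qoi.rep_eq tc_def mix_def)
qed

text \<open>A partial map from \<open>D\<close> to stores is rendered as a relation, so that running a command is
  relational composition.\<close>

definition agree :: "'d rel \<Rightarrow> ('d \<Rightarrow> ('v \<Rightarrow> 'val) \<Rightarrow> bool) \<Rightarrow> 'v set \<Rightarrow> bool" where
  "agree P H A \<longleftrightarrow>
    (\<forall>d d' s s'. (d, d') \<in> P \<longrightarrow> H d s \<longrightarrow> H d' s' \<longrightarrow> (\<forall>v\<in>A. s v = s' v))"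

text \<open>Legality of a mediator restated for relations, as an invariant to be carried through a
  command. As witnesses are reflexive, it also forces \<open>H\<close> to be single-valued.\<close>

definition labels :: "('v \<Rightarrow> 'd qoi) \<Rightarrow> ('d \<Rightarrow> ('v \<Rightarrow> 'val) \<Rightarrow> bool) \<Rightarrow> bool" where
  "labels \<Gamma> H \<longleftrightarrow> (\<forall>v. \<exists>P\<in>Rep_qoi (\<Gamma> v). agree P H {v})"

lemma agreeD: "agree P H A \<Longrightarrow> (d, d') \<in> P \<Longrightarrow> H d s \<Longrightarrow> H d' s' \<Longrightarrow> v \<in> A \<Longrightarrow> s v = s' v"
  unfolding agree_def by blast

lemma agree_subset: "agree P H A \<Longrightarrow> P' \<subseteq> P \<Longrightarrow> H' \<le> H \<Longrightarrow> agree P' H' A"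
  unfolding agree_def le_fun_def le_bool_def by blast

lemma labels_mono: "labels \<Gamma> H \<Longrightarrow> \<Gamma> \<le> \<Gamma>' \<Longrightarrow> H' \<le> H \<Longrightarrow> labels \<Gamma>' H'"
  unfolding labels_def by (meson agree_subset le_funD order_refl qoi_mem_mono)

text \<open>A label that has a witness contains the total relation by downward closure, hence lies
  above 1.\<close>

lemma labels_env1: "labels \<Gamma> H \<Longrightarrow> env1 \<Gamma>"
  unfolding labels_def env1_def one_le_qoi_iff using UNIV_in_qoi by blast

lemma labels_prod:
  fixes H :: "'d \<Rightarrow> ('v::finite \<Rightarrow> 'val) \<Rightarrow> bool"
  assumes "labels \<Gamma> H"
  obtains P where "P \<in> Rep_qoi (prod \<Gamma> A)" "agree P H A"
proof -
  obtain f where f: "\<And>v. f v \<in> Rep_qoi (\<Gamma> v)" "\<And>v. agree (f v) H {v}"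
    using assms unfolding labels_def by metis
  show ?thesis
    by (rule that[of "\<Inter>v\<in>A. f v"])
      (use f in \<open>auto simp: agree_def intro!: INT_in_prod_qoi\<close>)
qed

lemma labels_tE:
  assumes "wf_language L" "labels \<Gamma> H"
  obtains P where "P \<in> Rep_qoi (tE L E \<Gamma>)"
    "\<And>d d' s s'. (d, d') \<in> P \<Longrightarrow> H d s \<Longrightarrow> H d' s' \<Longrightarrow> ev L E s = ev L E s'"
proof -
  obtain P where P: "P \<in> Rep_qoi (tE L E \<Gamma>)" "agree P H (fv L E)"
    using labels_prod[OF assms(2), of "fv L E"] unfolding tE_def .
  have "ev L E s = ev L E s'" if "(d, d') \<in> P" "H d s" "H d' s'" for d d' s s'
    using assms(1) agreeD[OF P(2) that] by (auto simp: wf_language_def)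
  with P(1) that show ?thesis by blast
qed

lemma one_le_mult: "1 \<le> a \<Longrightarrow> 1 \<le> b \<Longrightarrow> 1 \<le> a * (b::'m::comm_quantale)"
  using quantale_mult_mono[of 1 a 1 b] by simp

lemma one_le_tE: "env1 \<Gamma> \<Longrightarrow> 1 \<le> tE L E \<Gamma>"
  unfolding tE_def by (rule one_le_prod) (simp add: env1_def)

lemma exec_unassigned: "exec L C s s' \<Longrightarrow> x \<notin> asgn C \<Longrightarrow> s' x = s x"
  by (induction rule: exec.induct) auto

section \<open>Soundness of the rules for loops, branches and assignments\<close>

definition iteration :: "('e, 'v, 'val) language \<Rightarrow> 'e \<Rightarrow> ('v, 'e) com \<Rightarrow> ('v \<Rightarrow> 'val) \<Rightarrow> ('v \<Rightarrow> 'val) \<Rightarrow> bool" where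
  "iteration L E C s s' \<longleftrightarrow> tst L (ev L E s) \<and> exec L C s s'"

lemma exec_While_iteration:
  "exec L (While E C) s s' \<Longrightarrow> \<exists>k. (iteration L E C ^^ k) s s' \<and> \<not> tst L (ev L E s')"
proof (induction "While E C" s s' rule: exec.induct)
  case (WhileTrue s s' s'')
  thus ?case by (meson iteration_def relpowp_Suc_I2)
next
  case (WhileFalse s)
  thus ?case by (intro exI[of _ 0]) simp
qed

text \<open>Dropping the guard from the last round only enlarges the relation, and
  \<open>labels\<close> passes to smaller relations. So the invariant survives any number of rounds
  without a charge for the guard.\<close>

lemma labels_iteration:
  assumes "labels \<Gamma> H" and "\<And>H. labels \<Gamma> H \<Longrightarrow> labels \<Gamma> (H OO exec L C)"
  shows "labels \<Gamma> (H OO (iteration L E C ^^ k))"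
proof (induction k)
  case 0
  have "H OO (iteration L E C ^^ 0) = H" by auto
  thus ?case using assms(1) by simp
next
  case (Suc k)
  have "H OO (iteration L E C ^^ Suc k) \<le> (H OO (iteration L E C ^^ k)) OO exec L C"
    by (auto simp: iteration_def)
  thus ?case by (rule labels_mono[OF assms(2)[OF Suc.IH] order_refl])
qed

text \<open>A run of \<open>k'\<close> rounds passes the guard after its first \<open>k\<close>
  rounds; this contradicts an exit after \<open>k\<close> rounds at a point sharing the guard
  value.\<close>

lemma relpowp_tst:
  "k < k' \<Longrightarrow> (iteration L E C ^^ k') s s' \<Longrightarrow>
    \<exists>u. (iteration L E C ^^ k) s u \<and> tst L (ev L E u)"
proof (induction k' arbitrary: s')
  case (Suc k')
  then obtain u where "(iteration L E C ^^ k') s u" "iteration L E C u s'" by auto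
  thus ?case using Suc by (cases "k = k'") (auto simp: iteration_def)
qed simp

text \<open>The intersection of \<open>N + 1\<close> witnesses lies in the power of \<open>t\<close>
  with exponent \<open>N + 1\<close>, one of the terms joined in \<open>star t\<close>.\<close>

lemma INT_in_star_qoi:
  assumes "\<And>i. P i \<in> Rep_qoi t"
  shows "(\<Inter>i\<le>N::nat. P i) \<in> Rep_qoi (star t)"
proof -
  have "(\<Inter>i\<le>N. P i) \<in> Rep_qoi (t ^ card {..N})"
    using INT_in_prod_qoi[of "{..N}" P "\<lambda>_. t"] assms by simp
  moreover have "t ^ card {..N} \<le> star t"
    unfolding star_def by (rule SUP_upper) simp
  ultimately show ?thesis by (rule qoi_mem_mono[rotated])
qed

text \<open>A bound \<open>N\<close> on the finitely many exit times suffices: on a cell of the guards of the rounds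
  up to \<open>N\<close>, all terminating runs leave the loop in the same round.\<close>

lemma labels_While:
  fixes H :: "'d::finite \<Rightarrow> ('v::finite \<Rightarrow> 'val) \<Rightarrow> bool"
  assumes wf: "wf_language L" and H: "labels \<Gamma> H"
    and step: "\<And>H. labels \<Gamma> H \<Longrightarrow> labels \<Gamma> (H OO exec L C)"
  shows "labels (\<lambda>x. if x \<in> asgn C then star (tE L E \<Gamma>) * \<Gamma> x else \<Gamma> x) (H OO exec L (While E C))"
  unfolding labels_def
proof
  fix x
  let ?t = "tE L E \<Gamma>"
  define I where "I k = H OO (iteration L E C ^^ k)" for k
  have I: "labels \<Gamma> (I k)" for k
    unfolding I_def by (rule labels_iteration[OF H step])
  define exits where "exits d k \<longleftrightarrow> (\<exists>s. I k d s \<and> \<not> tst L (ev L E s))" for d k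
  have run: "\<exists>k. I k d s \<and> \<not> tst L (ev L E s)" if "(H OO exec L (While E C)) d s" for d s
  proof -
    obtain u where u: "H d u" "exec L (While E C) u s" using \<open>(H OO _) d s\<close> by (rule relcomppE)
    from exec_While_iteration[OF u(2)] u(1) show ?thesis unfolding I_def by (blast intro: relcomppI)
  qed
  have "\<exists>P\<in>Rep_qoi ?t. \<forall>d d' s s'. (d, d') \<in> P \<longrightarrow> I k d s \<longrightarrow> I k d' s' \<longrightarrow> ev L E s = ev L E s'" for k
    by (rule labels_tE[OF wf I[of k], of E]) blast
  then obtain P where P: "\<And>k. P k \<in> Rep_qoi ?t"
    "\<And>k d d' s s'. (d, d') \<in> P k \<Longrightarrow> I k d s \<Longrightarrow> I k d' s' \<Longrightarrow> ev L E s = ev L E s'"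
    by metis
  have refl: "(d, d) \<in> P k" for d k
    using Rep_qoi_equiv[OF P(1)] by (auto simp: equiv_def refl_on_def)
  have psym: "(d', d) \<in> P k" if "(d, d') \<in> P k" for d d' k
    using Rep_qoi_equiv[OF P(1)[of k]] that by (auto simp: equiv_def sym_def)
  \<comment> \<open>Points related by \<open>P k\<close> agree on the guard after \<open>k\<close>
    rounds, so one cannot leave there while the other goes on.\<close>
  have not_less: "\<not> k < k'" if d: "(d, d') \<in> P k" "exits d k" "exits d' k'" for d d' k k'
  proof
    assume "k < k'"
    obtain s' where "I k' d' s'" using d by (auto simp: exits_def)
    then obtain r where r: "H d' r" "(iteration L E C ^^ k') r s'" unfolding I_def by (rule relcomppE)
    obtain u where u: "I k d' u" "tst L (ev L E u)"
      unfolding I_def using relpowp_tst[OF \<open>k < k'\<close> r(2)] r(1) by blast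
    obtain s where s: "I k d s" "\<not> tst L (ev L E s)" using d by (auto simp: exits_def)
    show False using P(2)[OF d(1) s(1) u(1)] s(2) u(2) by simp
  qed
  have same: "k = k'" if "(d, d') \<in> P k" "(d, d') \<in> P k'" "exits d k" "exits d' k'" for d d' k k'
    using not_less[OF that(1,3,4)] not_less[OF psym[OF that(2)] that(4,3)] by simp
  \<comment> \<open>The maximum exists because \<open>D\<close> is finite. At a point without an
    exit the chosen number is arbitrary and can only enlarge the bound.\<close>
  define N where "N = Max (range (\<lambda>d. SOME k. exits d k))"
  have le_N: "k \<le> N" if "exits d k" for d k
  proof -
    have "k = (SOME k. exits d k)"
      by (rule same[OF refl refl that someI]) (rule that)
    thus ?thesis unfolding N_def by simp
  qed
  show "\<exists>Q\<in>Rep_qoi (if x \<in> asgn C then star ?t * \<Gamma> x else \<Gamma> x). agree Q (H OO exec L (While E C)) {x}"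
  proof (cases "x \<in> asgn C")
    case True
    have "\<forall>k. \<exists>R. R \<in> Rep_qoi (\<Gamma> x) \<and> agree R (I k) {x}"
      using I unfolding labels_def by blast
    then obtain R where R: "\<And>k. R k \<in> Rep_qoi (\<Gamma> x)" "\<And>k. agree (R k) (I k) {x}"
      by metis
    define T where "T = (\<Inter>i\<le>N. P i)"
    have T: "T \<in> Rep_qoi (star ?t)" unfolding T_def by (rule INT_in_star_qoi[OF P(1)])
    note eT = Rep_qoi_equiv[OF T]
    \<comment> \<open>The exit round is read off the whole cell of \<open>T\<close>, so that it is
      constant on cells even at points where no run exits.\<close>
    define K where "K d = (SOME k. \<exists>d'. (d, d') \<in> T \<and> exits d' k)" for d
    have K: "K d = k" if "exits d k" for d k
    proof -
      have "(d, d) \<in> T" using refl by (simp add: T_def)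
      hence "\<exists>d'. (d, d') \<in> T \<and> exits d' (K d)"
        unfolding K_def by (intro someI[of "\<lambda>k. \<exists>d'. (d, d') \<in> T \<and> exits d' k"]) (use that in blast)
      then obtain d' where d': "(d, d') \<in> T" "exits d' (K d)" by blast
      have "k = K d"
        by (rule same[OF _ _ that d'(2)]) (use d' le_N that in \<open>auto simp: T_def\<close>)
      thus ?thesis by simp
    qed
    have "K d = K d'" if "(d, d') \<in> T" for d d'
    proof -
      have "(d, e) \<in> T \<longleftrightarrow> (d', e) \<in> T" for e
        using eT that unfolding equiv_def sym_def trans_def by blast
      thus ?thesis by (simp add: K_def)
    qed
    hence "{(d, d'). (d, d') \<in> T \<and> (d, d') \<in> R (K d)} \<in> Rep_qoi (star ?t * \<Gamma> x)"
      by (intro cellwise_in_mult_qoi[OF T R(1)]) simp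
    moreover have "agree {(d, d'). (d, d') \<in> T \<and> (d, d') \<in> R (K d)} (H OO exec L (While E C)) {x}"
      unfolding agree_def
    proof (intro allI impI)
      fix d d' s s'
      assume d: "(d, d') \<in> {(d, d'). (d, d') \<in> T \<and> (d, d') \<in> R (K d)}"
        and s: "(H OO exec L (While E C)) d s" and s': "(H OO exec L (While E C)) d' s'"
      obtain k where k: "I k d s" "\<not> tst L (ev L E s)" using run[OF s] by blast
      obtain k' where k': "I k' d' s'" "\<not> tst L (ev L E s')" using run[OF s'] by blast
      have ex: "exits d k" "exits d' k'" using k k' by (auto simp: exits_def)
      have "k = k'"
        by (rule same[OF _ _ ex]) (use d le_N ex in \<open>auto simp: T_def\<close>)
      thus "\<forall>v\<in>{x}. s v = s' v"
        using agreeD[OF R(2)[of k], of d d' s s' x] d k k' K[OF ex(1)] by auto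
    qed
    ultimately show ?thesis using True by auto
  next
    case False
    obtain Q where Q: "Q \<in> Rep_qoi (\<Gamma> x)" "agree Q H {x}"
      using H by (auto simp: labels_def)
    \<comment> \<open>An unassigned variable keeps its initial value, so its old witness still
      serves.\<close>
    have "agree Q (H OO exec L (While E C)) {x}"
      unfolding agree_def
    proof (intro allI impI, elim relcomppE)
      fix d d' s s' u u'
      assume "(d, d') \<in> Q" "H d u" "H d' u'" "exec L (While E C) u s" "exec L (While E C) u' s'"
      thus "\<forall>v\<in>{x}. s v = s' v"
        using agreeD[OF Q(2), of d d' u u' x] exec_unassigned[of L "While E C" _ _ x] False
        by (metis (no_types, lifting) asgn.simps(5) singletonD singletonI)
    qed
    thus ?thesis using Q(1) False by auto
  qed
qed

text \<open>All runs from one cell of \<open>T\<close> take the same branch, and the witness of that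
  branch is used on the cell. Gluing along \<open>T\<close> costs one tensor with the guard's
  label.\<close>

lemma labels_If:
  fixes H :: "'d \<Rightarrow> ('v::finite \<Rightarrow> 'val) \<Rightarrow> bool"
  assumes wf: "wf_language L" and H: "labels \<Gamma> H"
    and G1: "labels \<Gamma>1 (H OO exec L C1)" and G2: "labels \<Gamma>2 (H OO exec L C2)"
  shows "labels (\<lambda>x. if x \<in> asgn C1 \<union> asgn C2 then tE L E \<Gamma> * sup (\<Gamma>1 x) (\<Gamma>2 x) else \<Gamma> x)
    (H OO exec L (If E C1 C2))"
  unfolding labels_def
proof
  fix x
  let ?t = "tE L E \<Gamma>"
  obtain T where T: "T \<in> Rep_qoi ?t"
    "\<And>d d' s s'. (d, d') \<in> T \<Longrightarrow> H d s \<Longrightarrow> H d' s' \<Longrightarrow> ev L E s = ev L E s'"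
    using labels_tE[OF wf H] by metis
  note eT = Rep_qoi_equiv[OF T(1)]
  show "\<exists>Q\<in>Rep_qoi (if x \<in> asgn C1 \<union> asgn C2 then ?t * sup (\<Gamma>1 x) (\<Gamma>2 x) else \<Gamma> x).
    agree Q (H OO exec L (If E C1 C2)) {x}"
  proof (cases "x \<in> asgn C1 \<union> asgn C2")
    case True
    obtain P1 P2 where P: "P1 \<in> Rep_qoi (\<Gamma>1 x)" "agree P1 (H OO exec L C1) {x}"
      "P2 \<in> Rep_qoi (\<Gamma>2 x)" "agree P2 (H OO exec L C2) {x}"
      using G1 G2 unfolding labels_def by metis
    \<comment> \<open>The branch is also defined through the cell, which settles points where
      \<open>H\<close> has no store.\<close>
    define b where "b d \<longleftrightarrow> (\<exists>d' s. (d, d') \<in> T \<and> H d' s \<and> tst L (ev L E s))" for d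
    define R where "R d = (if b d then P1 else P2)" for d
    have b: "b d \<longleftrightarrow> tst L (ev L E s)" if "H d s" for d s
    proof
      show "b d" if "tst L (ev L E s)"
        using eT \<open>H d s\<close> that unfolding b_def equiv_def refl_on_def by blast
      show "tst L (ev L E s)" if "b d"
        using that T(2)[OF _ \<open>H d s\<close>] unfolding b_def by auto
    qed
    have bT: "b d = b d'" if "(d, d') \<in> T" for d d'
    proof -
      have "(d, e) \<in> T \<longleftrightarrow> (d', e) \<in> T" for e
        using eT that unfolding equiv_def sym_def trans_def by blast
      thus ?thesis by (simp add: b_def)
    qed
    have "R d \<in> Rep_qoi (sup (\<Gamma>1 x) (\<Gamma>2 x))" for d
      using P(1,3) by (auto simp: R_def intro: qoi_mem_mono[OF sup_ge1] qoi_mem_mono[OF sup_ge2])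
    hence "{(d, d'). (d, d') \<in> T \<and> (d, d') \<in> R d} \<in> Rep_qoi (?t * sup (\<Gamma>1 x) (\<Gamma>2 x))"
      by (rule cellwise_in_mult_qoi[OF T(1)]) (simp add: R_def bT)
    moreover have "agree {(d, d'). (d, d') \<in> T \<and> (d, d') \<in> R d} (H OO exec L (If E C1 C2)) {x}"
      unfolding agree_def
    proof (intro allI impI, elim relcomppE)
      fix d d' s s' u u'
      assume d: "(d, d') \<in> {(d, d'). (d, d') \<in> T \<and> (d, d') \<in> R d}"
        and u: "H d u" "H d' u'"
        and s: "exec L (If E C1 C2) u s" "exec L (If E C1 C2) u' s'"
      have tst: "tst L (ev L E u) = tst L (ev L E u')"
        using T(2)[of d d' u u'] d u by simp
      show "\<forall>v\<in>{x}. s v = s' v"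
      proof (cases "tst L (ev L E u)")
        case True
        hence "exec L C1 u s" "exec L C1 u' s'" using s tst by (auto elim: exec.cases)
        moreover have "(d, d') \<in> P1" using d True b[OF u(1)] by (simp add: R_def)
        ultimately show ?thesis using agreeD[OF P(2), of d d' s s' x] u by blast
      next
        case False
        hence "exec L C2 u s" "exec L C2 u' s'" using s tst by (auto elim: exec.cases)
        moreover have "(d, d') \<in> P2" using d False b[OF u(1)] by (simp add: R_def)
        ultimately show ?thesis using agreeD[OF P(4), of d d' s s' x] u by blast
      qed
    qed
    ultimately show ?thesis using True by auto
  next
    case False
    obtain Q where Q: "Q \<in> Rep_qoi (\<Gamma> x)" "agree Q H {x}"
      using H by (auto simp: labels_def)
    have "agree Q (H OO exec L (If E C1 C2)) {x}"
      unfolding agree_def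
    proof (intro allI impI, elim relcomppE)
      fix d d' s s' u u'
      assume "(d, d') \<in> Q" "H d u" "H d' u'" "exec L (If E C1 C2) u s" "exec L (If E C1 C2) u' s'"
      thus "\<forall>v\<in>{x}. s v = s' v"
        using agreeD[OF Q(2), of d d' u u' x] exec_unassigned[of L "If E C1 C2" _ _ x] False
        by (metis (no_types, lifting) asgn.simps(4) singletonD singletonI)
    qed
    thus ?thesis using Q(1) False by auto
  qed
qed

lemma labels_Assign:
  fixes H :: "'d \<Rightarrow> ('v::finite \<Rightarrow> 'val) \<Rightarrow> bool"
  assumes wf: "wf_language L" and H: "labels \<Gamma> H" and p: "1 \<le> p"
  shows "labels (\<Gamma>(y := p * tE L E \<Gamma>)) (H OO exec L (Assign y E))"
  unfolding labels_def
proof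
  fix x
  have ex: "s' = s(y := ev L E s)" if "exec L (Assign y E) s s'" for s s'
    using that by (auto elim: exec.cases)
  show "\<exists>Q\<in>Rep_qoi ((\<Gamma>(y := p * tE L E \<Gamma>)) x). agree Q (H OO exec L (Assign y E)) {x}"
  proof (cases "x = y")
    case True
    obtain P where P: "P \<in> Rep_qoi (tE L E \<Gamma>)"
      "\<And>d d' s s'. (d, d') \<in> P \<Longrightarrow> H d s \<Longrightarrow> H d' s' \<Longrightarrow> ev L E s = ev L E s'"
      using labels_tE[OF wf H] by metis
    have "P \<in> Rep_qoi (p * tE L E \<Gamma>)"
      by (rule qoi_mem_mono[OF _ P(1)]) (use quantale_mult_mono[OF p order_refl] in simp)
    moreover have "agree P (H OO exec L (Assign y E)) {x}"
      unfolding agree_def using P(2) True by (auto dest!: ex)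
    ultimately show ?thesis using True by auto
  next
    case False
    obtain Q where Q: "Q \<in> Rep_qoi (\<Gamma> x)" "agree Q H {x}"
      using H by (auto simp: labels_def)
    have "agree Q (H OO exec L (Assign y E)) {x}"
      using Q(2) False unfolding agree_def by (auto dest!: ex)
    thus ?thesis using Q(1) False by auto
  qed
qed

text \<open>Induction on the command, for every relation \<open>H\<close> at once, since sequencing
  and loops change the relation.\<close>

lemma noninterference:
  fixes H :: "'d::finite \<Rightarrow> ('v::finite \<Rightarrow> 'val) \<Rightarrow> bool"
  assumes wf: "wf_language L"
  shows "labels \<Gamma> H \<Longrightarrow> 1 \<le> p \<Longrightarrow> labels (alg L C p \<Gamma>) (H OO exec L C)"
proof (induction C arbitrary: \<Gamma> H p)
  case Skip
  have "H OO exec L Skip \<le> H" by (auto elim: exec.cases)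
  with Skip show ?case by (auto intro: labels_mono)
next
  case (Assign y E)
  thus ?case unfolding alg.simps by (rule labels_Assign[OF wf])
next
  case (Seq C1 C2)
  have "H OO exec L (Seq C1 C2) \<le> (H OO exec L C1) OO exec L C2"
    by (auto elim!: exec.cases[of L "Seq C1 C2"])
  with Seq.IH(2)[OF Seq.IH(1)[OF Seq.prems] Seq.prems(2)] show ?case
    by (auto intro: labels_mono)
next
  case (If E C1 C2)
  have "1 \<le> p * tE L E \<Gamma>"
    by (intro one_le_mult one_le_tE If.prems labels_env1[OF If.prems(1)])
  thus ?case
    unfolding alg.simps Let_def by (intro labels_If[OF wf] If.IH If.prems)
next
  case (While E C)
  define \<Theta> where "\<Theta> = lfp (loop_step L E C p \<Gamma>)"
  have "loop_step L E C p \<Gamma> \<Theta> = \<Theta>"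
    unfolding \<Theta>_def by (rule lfp_fixpoint[OF mono_loop_step])
  \<comment> \<open>The fixed point \<Theta> lies above the initial environment and is closed under
    the body, which makes it a loop invariant.\<close>
  hence le: "\<Gamma> \<le> \<Theta>" "alg L C (p * tE L E \<Theta>) \<Theta> \<le> \<Theta>"
    unfolding loop_step_def by (metis sup_ge1, metis sup_ge2)
  have H: "labels \<Theta> H" by (rule labels_mono[OF While.prems(1) le(1) order_refl])
  have "1 \<le> p * tE L E \<Theta>"
    by (intro one_le_mult one_le_tE While.prems labels_env1[OF H])
  hence "labels \<Theta> (H OO exec L C)" if "labels \<Theta> H" for H
    using While.IH[OF that] le(2) by (blast intro: labels_mono)
  thus ?case
    unfolding alg_While Let_def \<Theta>_def[symmetric] by (rule labels_While[OF wf H])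
qed


section \<open>Sound read-outs\<close>

text \<open>For an equivalence \<open>P\<close> this is its principal downset, the least label with
  witness \<open>P\<close>.\<close>

lift_definition principal :: "'d rel \<Rightarrow> 'd qoi" is "\<lambda>P. {Q \<in> LoI. P \<subseteq> Q}"
proof -
  fix P :: "'d rel"
  have sub: "{Q \<in> LoI. P \<subseteq> Q} \<subseteq> LoI" by auto
  \<comment> \<open>Each cell of a mix is a cell of some relation containing \<open>P\<close>, so
    the mix contains \<open>P\<close> as well.\<close>
  have "P \<subseteq> Q" if "Q \<in> mix {Q \<in> LoI. P \<subseteq> Q}" for Q
  proof (rule subrelI)
    fix x y assume "(x, y) \<in> P"
    obtain R where "R \<in> LoI" "P \<subseteq> R" "Q `` {x} = R `` {x}"
      using \<open>Q \<in> _\<close> unfolding mix_cell[OF sub] by blast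
    with \<open>(x, y) \<in> P\<close> show "(x, y) \<in> Q" by blast
  qed
  hence "tc {Q \<in> LoI. P \<subseteq> Q} \<subseteq> {Q \<in> LoI. P \<subseteq> Q}" by (auto simp: tc_def)
  thus "tc {Q \<in> LoI. P \<subseteq> Q} = {Q \<in> LoI. P \<subseteq> Q}" using tc_ext[OF sub] by blast
qed

lemma principal_idem: "principal P * principal P = principal P"
proof -
  have sub: "joins (Rep_qoi (principal P)) (Rep_qoi (principal P)) = Rep_qoi (principal P)"
    using equiv_Int by (fastforce simp: principal.rep_eq joins_def LoI_def)
  show ?thesis
    by (rule Rep_qoi_inject[THEN iffD1]) (simp add: times_qoi.rep_eq sub)
qed

lemma principal_le_iff:
  assumes "equiv UNIV P"
  shows "principal P \<le> q \<longleftrightarrow> P \<in> Rep_qoi q"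
  using assms by (auto simp: less_eq_qoi.rep_eq principal.rep_eq LoI_def intro: Rep_qoi_coarser)

lemma env1_principal: "env1 (\<lambda>v. principal (P v))"
  by (simp add: env1_def one_le_qoi_iff principal.rep_eq LoI_def equiv_UNIV)

lemma set_ext_mono: "(\<And>v. \<sigma> v \<le> \<tau> v) \<Longrightarrow> \<alpha> \<sigma> a \<le> \<alpha> \<tau> a"
  unfolding set_ext_def by (intro SUP_mono' quantale_prod_mono)

lemma sem_exec: "sem L C s = Some s' \<Longrightarrow> exec L C s s'"
proof -
  assume s: "sem L C s = Some s'"
  then obtain u where u: "exec L C s u" by (auto simp: sem_def split: if_splits)
  hence "(THE s'. exec L C s s') = u" by (blast intro: exec_deterministic)
  thus ?thesis using s u by (auto simp: sem_def split: if_splits)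
qed

lemma sound_readout_set_ext:
  fixes L :: "('e, 'v::finite, 'val) language" and \<sigma> :: "'v \<Rightarrow> 'd::finite qoi"
  assumes wf: "wf_language L"
  shows "sound_readout L \<sigma> (\<alpha> \<sigma>)"
  unfolding sound_readout_def
proof (intro allI impI)
  fix C W and g :: "'v \<Rightarrow> 'd \<rightharpoonup> 'val"
  assume "legal \<sigma> g"
  then obtain P where P: "\<And>v. P v \<in> Rep_qoi (\<sigma> v)"
    and g: "\<And>v d d'. (d, d') \<in> P v \<Longrightarrow> g v d \<noteq> None \<Longrightarrow> g v d' \<noteq> None \<Longrightarrow> g v d = g v d'"
    unfolding legal_def factors_def by metis
  note eP = Rep_qoi_equiv[OF P]
  \<comment> \<open>Only the chosen witnesses matter for this mediator, so \<sigma> is lowered to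
    their principal labels. These are idempotent, which makes \<open>\<alpha> \<tau>\<close> bound
    the directly computed labels.\<close>
  define \<tau> where "\<tau> v = principal (P v)" for v
  define H where "H d s \<longleftrightarrow> store_of g d = Some s" for d s
  have H: "H d s \<longleftrightarrow> (\<forall>v. g v d = Some (s v))" for d s
  proof
    show "\<forall>v. g v d = Some (s v)" if "H d s"
    proof
      fix v
      have "\<exists>y. g v d = Some y" "s = (\<lambda>v. the (g v d))"
        using that by (auto simp: H_def store_of_def split: if_splits)
      thus "g v d = Some (s v)" by auto
    qed
    show "H d s" if "\<forall>v. g v d = Some (s v)"
      using that by (simp add: H_def store_of_def dom_def)
  qed
  have "P v \<in> Rep_qoi (\<tau> v)" for v
    using principal_le_iff[OF eP, of v "\<tau> v"] by (simp add: \<tau>_def)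
  moreover have "agree (P v) H {v}" for v
    unfolding agree_def H using g[of _ _ v] by fastforce
  ultimately have "labels \<tau> H" unfolding labels_def by blast
  hence "labels (alg L C 1 \<tau>) (H OO exec L C)" by (rule noninterference[OF wf]) simp
  then obtain Q where Q: "Q \<in> Rep_qoi (joint L C \<tau> W)" "agree Q (H OO exec L C) W"
    unfolding joint_def by (rule labels_prod)
  have "joint L C \<tau> W \<le> \<alpha> \<tau> (\<J> L C W)"
    unfolding \<tau>_def by (rule joint_le_set_ext[OF env1_principal principal_idem])
  also have "\<dots> \<le> \<alpha> \<sigma> (\<J> L C W)"
    by (rule set_ext_mono) (simp add: \<tau>_def principal_le_iff[OF eP] P)
  finally have "Q \<in> Rep_qoi (\<alpha> \<sigma> (\<J> L C W))" using Q(1) by (rule qoi_mem_mono)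
  moreover have "observe L C W g d = observe L C W g d'"
    if d: "(d, d') \<in> Q" and def: "observe L C W g d \<noteq> None" "observe L C W g d' \<noteq> None" for d d'
  proof -
    have *: "\<exists>s. (H OO exec L C) e s \<and> observe L C W g e = Some (restrict s W)"
      if "observe L C W g e \<noteq> None" for e
      using that sem_exec by (fastforce simp: observe_def H_def bind_eq_Some_conv)
    obtain s where s: "(H OO exec L C) d s" "observe L C W g d = Some (restrict s W)"
      using *[OF def(1)] by blast
    obtain s' where s': "(H OO exec L C) d' s'" "observe L C W g d' = Some (restrict s' W)"
      using *[OF def(2)] by blast
    have "restrict s W = restrict s' W"
      using Q(2) d s(1) s'(1) unfolding agree_def by (intro restrict_ext) blast
    thus ?thesis by (simp only: s(2) s'(2))
  qed
  ultimately show "factors (observe L C W g) (\<alpha> \<sigma> (\<J> L C W))"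
    unfolding factors_def by blast
qed

text \<open>Every principal downset of \<open>\<P>(Var)\<close> is thus the joint type of
  \<open>Skip\<close>, so soundness for this one command constrains a read-out at all of
  them.\<close>

lemma Rep_set_joint_Skip: "Rep_setU (\<J> L Skip X) = Pow X"
proof -
  have "Rep_setU (prod set_gen X) = Pow X" if "finite X" for X :: "'a::finite set"
    using that
  proof (induction X)
    case empty
    show ?case by (auto simp: one_setU.rep_eq down_def)
  next
    case (insert x X)
    show ?case
      unfolding prod.insert[OF insert.hyps] set_eq_iff Rep_setU_mult_iff insert.IH set_gen.rep_eq
      by (auto simp: down_def)
  qed
  thus ?thesis by (simp add: set_joint_def set_type_def)
qed

lemma sem_Skip: "sem L Skip s = Some s"
proof -
  have "exec L Skip s = (\<lambda>s'. s' = s)" by (auto elim: exec.cases intro: exec.Skip)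
  thus ?thesis by (simp add: sem_def)
qed

text \<open>The mediator sending \<open>d\<close> to the codes of its cells forces every sound read-out to contain
  all intersections of witnesses.\<close>

lemma sound_readout_Skip:
  fixes L :: "('e, 'v::finite, 'val) language" and \<sigma> :: "'v \<Rightarrow> 'd qoi"
  assumes enc: "\<forall>P \<in> (LoI :: 'd rel set). \<exists>enc :: 'd set \<Rightarrow> 'val. inj_on enc (UNIV // P)"
    and \<sigma>: "env1 \<sigma>" and \<beta>: "sound_readout L \<sigma> \<beta>"
  shows "prod \<sigma> X \<le> \<beta> (\<J> L Skip X)"
proof (rule prod_qoi_le)
  fix f assume f: "\<And>w. w \<in> X \<Longrightarrow> f w \<in> Rep_qoi (\<sigma> w)"
  \<comment> \<open>Variables outside \<open>X\<close> receive the total relation, hence a constant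
    mediator component.\<close>
  define P where "P v = (if v \<in> X then f v else UNIV)" for v
  have UNIV: "UNIV \<in> Rep_qoi (\<sigma> v)" for v
    using \<sigma> by (simp add: env1_def one_le_qoi_iff)
  have P: "P v \<in> Rep_qoi (\<sigma> v)" for v using f UNIV by (simp add: P_def)
  note eP = Rep_qoi_equiv[OF P]
  obtain c :: "'v \<Rightarrow> 'd set \<Rightarrow> 'val" where c: "\<And>v. inj_on (c v) (UNIV // P v)"
  proof -
    have "\<forall>v. \<exists>c :: 'd set \<Rightarrow> 'val. inj_on c (UNIV // P v)"
      using enc eP by (simp add: LoI_def)
    from choice[OF this] show thesis using that by blast
  qed
  define g where "g v d = Some (c v (P v `` {d}))" for v d
  have "mediator g" by (auto simp: mediator_def g_def dom_def)
  moreover have "legal \<sigma> g"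
    unfolding legal_def factors_def
  proof
    fix v
    show "\<exists>Q\<in>Rep_qoi (\<sigma> v). \<forall>d d'. (d, d') \<in> Q \<longrightarrow> g v d \<noteq> None \<longrightarrow> g v d' \<noteq> None \<longrightarrow> g v d = g v d'"
      by (rule bexI[OF _ P]) (simp add: g_def equiv_class_eq[OF eP])
  qed
  ultimately have "factors (observe L Skip X g) (\<beta> (\<J> L Skip X))"
    using \<beta> by (simp add: sound_readout_def)
  moreover have obs: "observe L Skip X g d = Some (restrict (\<lambda>v. c v (P v `` {d})) X)" for d
    by (simp add: observe_def store_of_def g_def dom_def sem_Skip)
  ultimately obtain Q where Q: "Q \<in> Rep_qoi (\<beta> (\<J> L Skip X))"
    "\<And>d d'. (d, d') \<in> Q \<Longrightarrow> restrict (\<lambda>v. c v (P v `` {d})) X = restrict (\<lambda>v. c v (P v `` {d'})) X"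
    unfolding factors_def by auto
  \<comment> \<open>Equal codes mean equal cells by injectivity, so the witness \<open>Q\<close> of
    the read-out refines every \<open>f w\<close>.\<close>
  have "(d, d') \<in> f w" if "(d, d') \<in> Q" "w \<in> X" for d d' w
  proof -
    have "c w (P w `` {d}) = c w (P w `` {d'})"
      using fun_cong[OF Q(2)[OF that(1)], of w] that(2) by simp
    hence "P w `` {d} = P w `` {d'}"
      using inj_onD[OF c] by (simp add: quotientI)
    hence "(d, d') \<in> P w" using eq_equiv_class[OF _ eP] by blast
    thus ?thesis using that(2) by (simp add: P_def)
  qed
  hence "Q \<subseteq> (\<Inter>w\<in>X. f w)" by auto
  thus "(\<Inter>w\<in>X. f w) \<in> Rep_qoi (\<beta> (\<J> L Skip X))"
    using Q(1) f Rep_qoi_equiv by (blast intro: Rep_qoi_coarser equiv_INT)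
qed simp

text \<open>For each \<open>X\<close> in \<open>a\<close> the downset generated by \<open>X\<close>
  lies below \<open>a\<close>, and monotonicity of \<beta> carries the bound for \<open>Skip\<close>
  over to \<open>a\<close>.\<close>

lemma readout_floor:
  fixes L :: "('e, 'v::finite, 'val) language" and \<sigma> :: "'v \<Rightarrow> 'd qoi"
  assumes "\<forall>P \<in> (LoI :: 'd rel set). \<exists>enc :: 'd set \<Rightarrow> 'val. inj_on enc (UNIV // P)"
    and "env1 \<sigma>" "sound_readout L \<sigma> \<beta>" "mono \<beta>"
  shows "\<alpha> \<sigma> a \<le> \<beta> a"
  unfolding set_ext_def
proof (rule SUP_least)
  fix X assume "X \<in> Rep_setU a"
  hence "\<J> L Skip X \<le> a"
    using Rep_setU[of a] unfolding less_eq_setU.rep_eq Rep_set_joint_Skip by (auto simp: down_iff)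
  thus "prod \<sigma> X \<le> \<beta> a"
    using sound_readout_Skip[OF assms(1-3)] monoD[OF assms(4)] by (blast intro: order_trans)
qed

theorem corollary3:
  fixes L :: "('e, 'v::finite, 'val) language"
    and \<sigma> :: "'v \<Rightarrow> 'd::finite qoi"
  assumes "wf_language L"
    and "\<forall>P \<in> (LoI :: 'd rel set). \<exists>enc :: 'd set \<Rightarrow> 'val. inj_on enc (UNIV // P)"
    and "env1 \<sigma>"
  shows "(\<forall>C W. \<alpha> \<sigma> (\<J> L C W) \<le> \<alpha>\<^sub>\<nat> \<sigma> (\<J>\<^sub>\<nat> L C W))
    \<and> (sound_readout L \<sigma> (\<alpha> \<sigma>) \<and> join_preserving (\<alpha> \<sigma>))
    \<and> (\<forall>C W \<beta>. sound_readout L \<sigma> \<beta> \<longrightarrow> join_preserving \<beta> \<longrightarrow>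
          \<alpha> \<sigma> (\<J> L C W) \<le> \<beta> (\<J> L C W))
    \<and> (\<forall>C W (\<iota> :: 'v \<Rightarrow> 'q::comm_quantale) (h :: ('v \<Rightarrow> 'd qoi) \<Rightarrow> 'q \<Rightarrow> 'd qoi) \<Delta>.
          type_object \<iota> h \<longrightarrow> env1 \<Delta> \<longrightarrow> typing L 1 \<iota> C \<Delta> \<longrightarrow>
          \<alpha>\<^sub>\<nat> \<sigma> (\<J>\<^sub>\<nat> L C W) \<le> h \<sigma> (\<Prod>w\<in>W. \<Delta> w))
    \<and> ((\<forall>C W. \<alpha> \<sigma> (\<J> L C W) = \<alpha>\<^sub>\<nat> \<sigma> (\<J>\<^sub>\<nat> L C W)) \<longleftrightarrow> (\<forall>v. \<sigma> v * \<sigma> v = \<sigma> v))"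
proof (intro conjI allI impI)
  show "\<alpha> \<sigma> (\<J> L C W) \<le> \<alpha>\<^sub>\<nat> \<sigma> (\<J>\<^sub>\<nat> L C W)" for C W
    unfolding nat_ext_joint[OF assms(3)] by (rule set_ext_joint_le[OF assms(3)])
  show "sound_readout L \<sigma> (\<alpha> \<sigma>)" by (rule sound_readout_set_ext[OF assms(1)])
  show "join_preserving (\<alpha> \<sigma>)" by (rule join_preserving_set_ext)
  show "\<alpha> \<sigma> (\<J> L C W) \<le> \<beta> (\<J> L C W)"
    if "sound_readout L \<sigma> \<beta>" "join_preserving \<beta>" for C W \<beta>
    by (rule readout_floor[OF assms(2,3) that(1) join_preserving_mono[OF that(2)]])
  show "\<alpha>\<^sub>\<nat> \<sigma> (\<J>\<^sub>\<nat> L C W) \<le> h \<sigma> (\<Prod>w\<in>W. \<Delta> w)"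
    if "type_object \<iota> h" "typing L 1 \<iota> C \<Delta>"
    for C W and \<iota> :: "'v \<Rightarrow> 'q" and h :: "('v \<Rightarrow> 'd qoi) \<Rightarrow> 'q \<Rightarrow> 'd qoi" and \<Delta>
    by (rule typing_ceiling[OF assms(3) that])
  show "(\<forall>C W. \<alpha> \<sigma> (\<J> L C W) = \<alpha>\<^sub>\<nat> \<sigma> (\<J>\<^sub>\<nat> L C W)) \<longleftrightarrow> (\<forall>v. \<sigma> v * \<sigma> v = \<sigma> v)"
  proof
    show "\<forall>v. \<sigma> v * \<sigma> v = \<sigma> v" if "\<forall>C W. \<alpha> \<sigma> (\<J> L C W) = \<alpha>\<^sub>\<nat> \<sigma> (\<J>\<^sub>\<nat> L C W)"
      using idempotent_of_ext_eq[OF assms(1,3)] that by blast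
    show "\<forall>C W. \<alpha> \<sigma> (\<J> L C W) = \<alpha>\<^sub>\<nat> \<sigma> (\<J>\<^sub>\<nat> L C W)" if "\<forall>v. \<sigma> v * \<sigma> v = \<sigma> v"
      unfolding nat_ext_joint[OF assms(3)]
      using set_ext_joint_le[OF assms(3)] joint_le_set_ext[OF assms(3)] that by (blast intro: antisym)
  qed
qed

end
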